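(* If $\alpha,\beta>0$, then $S_{\alpha,\beta}$ is a $PC^1$ mapping, that is: $S_{\alpha,\beta}$ is continuous and for every $\bar x\in\mathbb{R}^n$ there exist finitely many $C^1$ mappings $\varphi_1,\dots,\varphi_\ell$, defined on a neighborhood of $\bar x$, such that for all $x$ sufficiently close to $\bar x$, $S_{\alpha,\beta}(x)\in\{\varphi_1(x),\dots,\varphi_\ell(x)\}$.
   Context: Standing assumptions: $g:\mathbb{R}^n\times\mathbb{R}^m\to\mathbb{R}$ and $G=(g_1,\dots,g_s):\mathbb{R}^n\times\mathbb{R}^m\to\mathbb{R}^s$ are $C^2$; for every $x\in\mathbb{R}^n$, $g(x,\cdot)$ and each $g_i(x,\cdot)$ are convex; $h:\mathbb{R}^s\to[-\infty,\infty]$ is proper, epi-polyhedral (its epigraph is a polyhedral set) and nondecreasing ($z\ge z'$ componentwise implies $h(z)\ge h(z')$). $h^*$ is the convex conjugate of $h$ and $\partial h^*$ its subdifferential. For $\alpha,\beta>0$, $S_{\alpha,\beta}(x)$ is the set of $(y,p)\in\mathbb{R}^m\times\mathbb{R}^s$ with $$0=-\nabla_yg(x,y)-\nabla_yG(x,y)^\top p-\beta y,\qquad 0\in -G(x,y)+\alpha p+\partial h^*(p),$$ where $\nabla_yG$ is the $s\times m$ Jacobian of $G$ in $y$. This set is a singleton for every $x$, so $S_{\alpha,\beta}$ is treated as a function $\mathbb{R}^n\to\mathbb{R}^m\times\mathbb{R}^s$. *)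

theory Defs
  imports "HOL-Analysis.Analysis"
begin

section \<open>Continuously differentiable maps\<close>

text \<open>
  Differentiability is meant in the ambient space, so \<open>C1_on U f\<close> is intended for open \<open>U\<close>.
  The derivative is a map into the normed space of bounded linear maps, so that its continuity,
  and for \<open>C2\<close> its continuous differentiability, refer to the operator norm.
\<close>

definition C1_on :: "'a::real_normed_vector set \<Rightarrow> ('a \<Rightarrow> 'b::real_normed_vector) \<Rightarrow> bool" where
  "C1_on U f \<longleftrightarrow>
     (\<exists>f' :: 'a \<Rightarrow> 'a \<Rightarrow>\<^sub>L 'b.
        (\<forall>x\<in>U. (f has_derivative blinfun_apply (f' x)) (at x)) \<and> continuous_on U f')"

definition C2 :: "('a::real_normed_vector \<Rightarrow> 'b::real_normed_vector) \<Rightarrow> bool" where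
  "C2 f \<longleftrightarrow>
     (\<exists>f' :: 'a \<Rightarrow> 'a \<Rightarrow>\<^sub>L 'b.
        (\<forall>x. (f has_derivative blinfun_apply (f' x)) (at x)) \<and> C1_on UNIV f')"

definition gradient :: "('a::real_inner \<Rightarrow> real) \<Rightarrow> 'a \<Rightarrow> 'a" where
  "gradient f x = (THE D. GDERIV f x :> D)"

text \<open>
  The neighbourhoods on which the finitely many selection functions are defined are intersected
  to a single open set \<open>U\<close>; values of the selections outside \<open>U\<close> are irrelevant.
\<close>

definition PC1 :: "('a::real_normed_vector \<Rightarrow> 'b::real_normed_vector) \<Rightarrow> bool" where
  "PC1 f \<longleftrightarrow>
     continuous_on UNIV f \<and>
     (\<forall>x0. \<exists>\<Phi> U. finite \<Phi> \<and> open U \<and> x0 \<in> U \<and> (\<forall>\<phi>\<in>\<Phi>. C1_on U \<phi>) \<and>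
        (\<forall>\<^sub>F x in nhds x0. f x \<in> (\<lambda>\<phi>. \<phi> x) ` \<Phi>))"

section \<open>Extended-real-valued convex analysis\<close>

definition proper_fun :: "('a \<Rightarrow> ereal) \<Rightarrow> bool" where
  "proper_fun h \<longleftrightarrow> (\<forall>z. h z \<noteq> -\<infinity>) \<and> (\<exists>z. h z \<noteq> \<infinity>)"

definition ereal_epigraph :: "('a \<Rightarrow> ereal) \<Rightarrow> ('a \<times> real) set" where
  "ereal_epigraph h = {(z, r). h z \<le> ereal r}"

definition epi_polyhedral :: "('a::euclidean_space \<Rightarrow> ereal) \<Rightarrow> bool" where
  "epi_polyhedral h \<longleftrightarrow> polyhedron (ereal_epigraph h)"

definition convex_conjugate :: "('a::real_inner \<Rightarrow> ereal) \<Rightarrow> 'a \<Rightarrow> ereal" where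
  "convex_conjugate h p = (SUP z. ereal (p \<bullet> z) - h z)"

text \<open>The subdifferential is empty wherever the function is not finite.\<close>

definition subdifferential :: "('a::real_inner \<Rightarrow> ereal) \<Rightarrow> 'a \<Rightarrow> 'a set" where
  "subdifferential f p =
     {v. \<bar>f p\<bar> \<noteq> \<infinity> \<and> (\<forall>q. f p + ereal (v \<bullet> (q - p)) \<le> f q)}"

section \<open>The regularised solution map\<close>

definition S_map ::
  "((real^'n) \<times> (real^'m) \<Rightarrow> real) \<Rightarrow> ((real^'n) \<times> (real^'m) \<Rightarrow> real^'s) \<Rightarrow>
   (real^'s \<Rightarrow> ereal) \<Rightarrow> real \<Rightarrow> real \<Rightarrow> real^'n \<Rightarrow> ((real^'m) \<times> (real^'s)) set" where
  "S_map g G h \<alpha> \<beta> x =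
     {(y, p).
        0 = - gradient (\<lambda>y. g (x, y)) y
            - transpose (jacobian (\<lambda>y. G (x, y)) (at y)) *v p - \<beta> *\<^sub>R y \<and>
        0 \<in> (\<lambda>v. - G (x, y) + \<alpha> *\<^sub>R p + v) ` subdifferential (convex_conjugate h) p}"

end

theory Submission
  imports Defs
begin

text \<open>
  By Fenchel duality the inclusion says that \<open>p\<close> is a subgradient of \<open>h\<close> at \<open>w = G(x,y) - \<alpha>p\<close>.
  For fixed \<open>x\<close> the system is then the first-order condition for minimising
  \<open>g(x,y) + r + |G(x,y) - w|\<^sup>2/(2\<alpha>) + \<beta>|y|\<^sup>2/2\<close> over \<open>y\<close> and \<open>(w,r)\<close> in the epigraph of \<open>h\<close>,
  with \<open>p = (G(x,y) - w)/\<alpha>\<close>; since \<open>h\<close> is nondecreasing, its affine minorants have nonnegative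
  slope, so the objective is coercive and a solution exists. Since \<open>p \<ge> 0\<close>, the functions
  \<open>p \<bullet> G(x,\<cdot>)\<close> are convex, and monotonicity of \<open>\<partial>h\<^sup>*\<close> gives the stability estimate
  \<open>\<alpha>|p - p\<^sub>0|\<^sup>2 + \<beta>|y - y\<^sub>0|\<^sup>2 \<le> \<close> (data perturbation) \<open>\<times>\<close> (distance), hence uniqueness and continuity.
  Because the epigraph is polyhedral, the resolvent \<open>z \<mapsto> p\<close> selects at each \<open>z\<close> one of finitely many
  affine maps \<open>A z + b\<close> with \<open>A\<close> positive semidefinite, one for each set of active constraints.
  Replacing the inclusion by \<open>p = A G(x,y) + b\<close> gives a \<open>C\<^sup>1\<close> system whose linearisation in \<open>(y,p)\<close>
  is injective, and the implicit function theorem yields the selections.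
\<close>

section \<open>Epigraphs and conjugate subgradients\<close>

text \<open>
  For the epigraph \<open>E\<close> of \<open>h\<close> this says \<open>p \<in> \<partial>h(v)\<close>; the inequality at \<open>w = v\<close> forces \<open>r = h v\<close>.
\<close>

definition epi_subgrad :: "('a::real_inner \<times> real) set \<Rightarrow> 'a \<Rightarrow> 'a \<Rightarrow> bool" where
  "epi_subgrad E v p \<longleftrightarrow> (\<exists>r. (v, r) \<in> E \<and> (\<forall>w t. (w, t) \<in> E \<longrightarrow> r + p \<bullet> (w - v) \<le> t))"

lemma epi_subgrad_monotone:
  assumes "epi_subgrad E v p" "epi_subgrad E v' p'"
  shows "0 \<le> (p - p') \<bullet> (v - v')"
proof -
  obtain r where r: "(v, r) \<in> E" "\<And>w t. (w, t) \<in> E \<Longrightarrow> r + p \<bullet> (w - v) \<le> t"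
    using assms(1) unfolding epi_subgrad_def by blast
  obtain r' where r': "(v', r') \<in> E" "\<And>w t. (w, t) \<in> E \<Longrightarrow> r' + p' \<bullet> (w - v') \<le> t"
    using assms(2) unfolding epi_subgrad_def by blast
  show ?thesis
    using r(2)[OF r'(1)] r'(2)[OF r(1)] by (simp add: inner_diff_left inner_diff_right)
qed

text \<open>From right to left, the subgradient inequality pins the value of the conjugate at
  \<open>p\<close>. From left to right is Fenchel-Moreau at \<open>v\<close>: were the candidate
  point outside the epigraph, a separating hyperplane would produce a \<open>q\<close> at which the
  subgradient inequality of the conjugate fails.\<close>

lemma subdifferential_conjugate_iff:
  fixes h :: "'a::euclidean_space \<Rightarrow> ereal"
  assumes "proper_fun h" and "convex (ereal_epigraph h)" and "closed (ereal_epigraph h)"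
  shows "v \<in> subdifferential (convex_conjugate h) p \<longleftrightarrow> epi_subgrad (ereal_epigraph h) v p"
proof
  let ?E = "ereal_epigraph h" and ?c = "convex_conjugate h"
  have not_minus_inf: "h z \<noteq> -\<infinity>" for z
    using assms(1) by (simp add: proper_fun_def)
  have conj_le: "?c q \<le> ereal s" if "\<And>w t. (w, t) \<in> ?E \<Longrightarrow> q \<bullet> w - t \<le> s" for q s
    unfolding convex_conjugate_def
  proof (rule SUP_least)
    fix z
    show "ereal (q \<bullet> z) - h z \<le> ereal s"
    proof (cases "h z")
      case (real t)
      then show ?thesis using that[of z t] by (simp add: ereal_epigraph_def)
    qed (use not_minus_inf[of z] in auto)
  qed
  have conj_ge: "ereal (q \<bullet> w - t) \<le> ?c q" if "(w, t) \<in> ?E" for q w t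
  proof -
    have "ereal (q \<bullet> w) - ereal t \<le> ereal (q \<bullet> w) - h w"
      using that by (intro ereal_minus_mono) (auto simp: ereal_epigraph_def)
    also have "\<dots> \<le> ?c q"
      unfolding convex_conjugate_def by (rule SUP_upper) simp
    finally show ?thesis by simp
  qed
  show "v \<in> subdifferential ?c p" if sg: "epi_subgrad ?E v p"
  proof -
    obtain r where r: "(v, r) \<in> ?E" "\<And>w t. (w, t) \<in> ?E \<Longrightarrow> r + p \<bullet> (w - v) \<le> t"
      using sg unfolding epi_subgrad_def by blast
    have "?c p \<le> ereal (p \<bullet> v - r)"
      using r(2) by (intro conj_le) (force simp: inner_diff_right)
    then have eq: "?c p = ereal (p \<bullet> v - r)"
      using conj_ge[OF r(1), of p] by simp
    have "?c p + ereal (v \<bullet> (q - p)) \<le> ?c q" for q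
      using conj_ge[OF r(1), of q] unfolding eq by (simp add: inner_diff_right inner_commute)
    then show ?thesis
      using eq by (simp add: subdifferential_def)
  qed
  show "epi_subgrad ?E v p" if sub: "v \<in> subdifferential ?c p"
  proof -
    obtain c where c: "?c p = ereal c"
      using sub unfolding subdifferential_def by (cases "?c p") auto
    have c_ge: "p \<bullet> w - t \<le> c" if "(w, t) \<in> ?E" for w t
      using conj_ge[OF that, of p] c by simp
    have c_sub: "c + v \<bullet> (q - p) \<le> s" if "?c q \<le> ereal s" for q s
    proof -
      have "ereal (c + v \<bullet> (q - p)) \<le> ?c q"
        using sub c unfolding subdifferential_def by auto
      with that have "ereal (c + v \<bullet> (q - p)) \<le> ereal s" by (rule order.trans[rotated])
      then show ?thesis by simp
    qed
    \<comment> \<open>The only possible height: equality in the Fenchel-Young inequality.\<close>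
    define r where "r = p \<bullet> v - c"
    have "(v, r) \<in> ?E"
    proof (rule ccontr)
      assume "(v, r) \<notin> ?E"
      then obtain n b where n: "n \<bullet> (v, r) < b" "\<And>x. x \<in> ?E \<Longrightarrow> b < n \<bullet> x"
        using separating_hyperplane_closed_point[OF assms(2,3)] by blast
      obtain a \<gamma> where n_def: "n = (a, \<gamma>)" by (cases n)
      have sep: "b < a \<bullet> w + \<gamma> * t" if "(w, t) \<in> ?E" for w t
        using n(2)[OF that] by (simp add: n_def)
      obtain w0 where "h w0 \<noteq> \<infinity>"
        using assms(1) by (auto simp: proper_fun_def)
      then obtain t0 where t0: "h w0 = ereal t0"
        using not_minus_inf[of w0] by (cases "h w0") auto
      \<comment> \<open>The epigraph is unbounded upwards, so a negative vertical component would
        violate \<open>sep\<close> high above \<open>w0\<close>.\<close>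
      have "\<gamma> \<ge> 0"
      proof (rule ccontr)
        assume "\<not> \<gamma> \<ge> 0"
        define t where "t = max t0 ((b - a \<bullet> w0) / \<gamma>)"
        have "b < a \<bullet> w0 + \<gamma> * t"
          by (rule sep) (simp add: ereal_epigraph_def t0 t_def)
        moreover have "\<gamma> * t \<le> \<gamma> * ((b - a \<bullet> w0) / \<gamma>)"
          using \<open>\<not> \<gamma> \<ge> 0\<close> by (intro mult_left_mono_neg) (auto simp: t_def)
        ultimately show False using \<open>\<not> \<gamma> \<ge> 0\<close> by simp
      qed
      \<comment> \<open>Moving \<open>p\<close> by a small step against \<open>a + \<gamma> p\<close> treats vertical separation (\<open>\<gamma> = 0\<close>) as well.\<close>
      define s where "s = 1 / (1 + \<gamma>)"
      have s: "s > 0" "s * \<gamma> \<le> 1"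
        using \<open>\<gamma> \<ge> 0\<close> by (auto simp: s_def field_simps)
      define q where "q = p - s *\<^sub>R (a + \<gamma> *\<^sub>R p)"
      have "?c q \<le> ereal ((1 - s * \<gamma>) * c - s * b)"
      proof (rule conj_le)
        fix w t assume wt: "(w, t) \<in> ?E"
        have "q \<bullet> w - t = (1 - s * \<gamma>) * (p \<bullet> w - t) - s * (a \<bullet> w + \<gamma> * t)"
          by (simp add: q_def inner_diff_left inner_add_left algebra_simps)
        also have "\<dots> \<le> (1 - s * \<gamma>) * c - s * b"
          using c_ge[OF wt] sep[OF wt] s by (intro diff_mono mult_left_mono) auto
        finally show "q \<bullet> w - t \<le> (1 - s * \<gamma>) * c - s * b" .
      qed
      \<comment> \<open>The terms in \<open>c\<close> regroup into \<open>r\<close>, and the result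
        contradicts strict separation of \<open>(v, r)\<close>.\<close>
      from c_sub[OF this] have "s * b \<le> s * (a \<bullet> v + \<gamma> * r)"
        by (simp add: q_def r_def inner_add_right inner_commute algebra_simps)
      then show False
        using n(1) s by (simp add: n_def)
    qed
    then show ?thesis
      unfolding epi_subgrad_def using c_ge by (force simp: r_def inner_diff_right)
  qed
qed

text \<open>Project the point \<open>(w0, r1)\<close> onto \<open>E\<close>. Since \<open>E\<close>
  contains a point vertically above it, the normal at the projection is not horizontal, and
  rescaling its vertical part to -1 gives a subgradient.\<close>

lemma epi_subgrad_exists:
  fixes E :: "('a::euclidean_space \<times> real) set"
  assumes "closed E" "convex E" "(w0, r0) \<in> E" "(w0, r1) \<notin> E" "r1 < r0"
  shows "\<exists>v p. epi_subgrad E v p"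
proof -
  obtain a where a: "a \<in> E" "\<And>u. u \<in> E \<Longrightarrow> dist (w0, r1) a \<le> dist (w0, r1) u"
    using distance_attains_inf[OF assms(1), of "(w0, r1)"] assms(3) by blast
  obtain v r where vr: "a = (v, r)" by (cases a)
  define c where "c = r - r1"
  have dot: "(w0 - v) \<bullet> (w - v) - c * (t - r) \<le> 0" if "(w, t) \<in> E" for w t
  proof -
    have "((w0, r1) - a) \<bullet> ((w, t) - a) \<le> 0"
      using a(2) by (intro any_closest_point_dot[OF assms(2,1) a(1) that]) blast
    then show ?thesis by (simp add: vr c_def algebra_simps)
  qed
  have "c > 0"
  proof (rule ccontr)
    assume "\<not> c > 0"
    \<comment> \<open>The projection inequality tested at \<open>(w0, r0)\<close>: for c \<le> 0
      both squares vanish, so the projected point would lie in \<open>E\<close>.\<close>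
    have "(w0 - v) \<bullet> (w0 - v) + c * c \<le> c * (r0 - r1)"
      using dot[OF assms(3)] by (simp add: c_def algebra_simps)
    also have "\<dots> \<le> 0"
      using \<open>\<not> c > 0\<close> assms(5) by (simp add: mult_nonpos_nonneg)
    finally have "(w0 - v) \<bullet> (w0 - v) = 0 \<and> c * c = 0"
      using inner_ge_zero[of "w0 - v"] zero_le_square[of c] by linarith
    then have "a = (w0, r1)" by (simp add: vr c_def)
    then show False using a(1) assms(4) by simp
  qed
  have "r + ((1/c) *\<^sub>R (w0 - v)) \<bullet> (w - v) \<le> t" if "(w, t) \<in> E" for w t
  proof -
    have "(w0 - v) \<bullet> (w - v) / c \<le> t - r"
      using dot[OF that] \<open>c > 0\<close> by (simp add: pos_divide_le_eq mult.commute)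
    then show ?thesis by simp
  qed
  then show ?thesis
    using a(1) unfolding epi_subgrad_def vr by blast
qed

text \<open>Lowering one coordinate of \<open>v\<close> keeps the point in the epigraph at the same
  height, so the slope in that coordinate cannot be negative.\<close>

lemma epi_subgrad_nonneg:
  fixes h :: "real^'s \<Rightarrow> ereal"
  assumes "mono h" "epi_subgrad (ereal_epigraph h) v p"
  shows "0 \<le> p $ i"
proof -
  obtain r where r: "(v, r) \<in> ereal_epigraph h"
      "\<And>w t. (w, t) \<in> ereal_epigraph h \<Longrightarrow> r + p \<bullet> (w - v) \<le> t"
    using assms(2) unfolding epi_subgrad_def by blast
  have "h (v - axis i 1) \<le> h v"
    by (rule monoD[OF assms(1)]) (simp add: less_eq_vec_def axis_def)
  with r(1) have "(v - axis i 1, r) \<in> ereal_epigraph h"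
    by (auto simp: ereal_epigraph_def)
  from r(2)[OF this] show ?thesis by (simp add: inner_axis)
qed

section \<open>Resolvents of polyhedral functions\<close>

text \<open>\<open>Q\<close> is the orthogonal projector onto the complement of \<open>V\<close>;
  its quadratic form at \<open>u\<close> is the squared norm of \<open>Q u\<close>.\<close>

lemma subspace_orthogonal_complement_projection:
  fixes V :: "'a::euclidean_space set"
  assumes "subspace V"
  obtains Q where "linear Q" "\<And>u. 0 \<le> u \<bullet> Q u"
    "\<And>u q. \<lbrakk>u \<in> V; \<And>w. w \<in> V \<Longrightarrow> q \<bullet> w = 0\<rbrakk> \<Longrightarrow> Q (u + q) = q"
proof -
  have span_V: "span V = V"
    using assms span_eq_iff by blast
  define W where "W = {q. \<forall>w\<in>V. q \<bullet> w = 0}"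
  have decomp: "\<exists>!q. q \<in> W \<and> x - q \<in> V" for x
  proof -
    obtain y z where yz: "y \<in> span V" "\<And>w. w \<in> span V \<Longrightarrow> orthogonal z w" "x = y + z"
      using orthogonal_subspace_decomp_exists[of V x] by blast
    have "z \<in> W \<and> x - z \<in> V"
      using yz unfolding span_V by (auto simp: W_def orthogonal_def)
    moreover have "q = z" if "q \<in> W" "x - q \<in> V" for q
    proof -
      have "z - q \<in> V"
        using subspace_diff[OF assms that(2)] yz unfolding span_V by fastforce
      moreover have "z \<in> W" using \<open>z \<in> W \<and> x - z \<in> V\<close> by simp
      ultimately have "(z - q) \<bullet> (z - q) = 0"
        using that(1) by (simp add: W_def inner_diff_left)
      then show ?thesis by simp
    qed
    ultimately show ?thesis by blast
  qed
  define Q where "Q x = (THE q. q \<in> W \<and> x - q \<in> V)" for x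
  have Q: "Q x \<in> W" "x - Q x \<in> V" for x
    using theI'[OF decomp[of x]] by (auto simp: Q_def)
  have Q_eq: "Q x = q" if "q \<in> W" "x - q \<in> V" for x q
    using decomp[of x] that Q by blast
  show thesis
  proof
    show "linear Q"
    proof (rule linearI)
      show "Q (x + y) = Q x + Q y" for x y
      proof (rule Q_eq)
        show "Q x + Q y \<in> W" using Q(1) by (simp add: W_def inner_add_left)
        show "x + y - (Q x + Q y) \<in> V"
          using subspace_add[OF assms Q(2)[of x] Q(2)[of y]] by (simp add: algebra_simps)
      qed
      show "Q (c *\<^sub>R x) = c *\<^sub>R Q x" for c x
      proof (rule Q_eq)
        show "c *\<^sub>R Q x \<in> W" using Q(1) by (simp add: W_def)
        show "c *\<^sub>R x - c *\<^sub>R Q x \<in> V"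
          using subspace_scale[OF assms Q(2)[of x], of c] by (simp add: algebra_simps)
      qed
    qed
    show "0 \<le> u \<bullet> Q u" for u
    proof -
      have "Q u \<bullet> (u - Q u) = 0" using Q[of u] by (simp add: W_def)
      then have "u \<bullet> Q u = Q u \<bullet> Q u" by (simp add: inner_diff_right inner_commute)
      then show ?thesis by simp
    qed
    show "Q (u + q) = q" if "u \<in> V" "\<And>w. w \<in> V \<Longrightarrow> q \<bullet> w = 0" for u q
      using that by (intro Q_eq) (auto simp: W_def)
  qed
qed

text \<open>The pieces are indexed by the subsets \<open>I\<close> of the finitely many half-spaces
  that cut out \<open>E\<close>. Once the active set is fixed, \<open>p\<close> is determined by
  \<open>z\<close> through linear equations.\<close>

lemma polyhedral_resolvent_piecewise_affine:
  fixes E :: "('a::euclidean_space \<times> real) set"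
  assumes "polyhedron E" and "\<alpha> > 0"
  obtains pieces :: "(('a \<Rightarrow> 'a) \<times> 'a) set"
  where "finite pieces" "\<And>A b. (A, b) \<in> pieces \<Longrightarrow> linear A \<and> (\<forall>u. 0 \<le> u \<bullet> A u)"
    "\<And>z p. epi_subgrad E (z - \<alpha> *\<^sub>R p) p \<Longrightarrow> \<exists>(A, b)\<in>pieces. p = A z + b"
proof -
  obtain F where F: "finite F" "E = \<Inter>F"
      "\<forall>H\<in>F. \<exists>a b. a \<noteq> 0 \<and> H = {x. a \<bullet> x \<le> b}"
    using assms(1) unfolding polyhedron_def by auto
  then obtain n b where nb: "\<And>H. H \<in> F \<Longrightarrow> H = {x. n H \<bullet> x \<le> b H}"
    by metis
  have E_iff: "x \<in> E \<longleftrightarrow> (\<forall>H\<in>F. n H \<bullet> x \<le> b H)" for x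
    using F(2) nb by blast
  define L where "L I = {v. \<forall>H\<in>I. n H \<bullet> v = 0}" for I
  have subsp_L: "subspace (L I)" for I
    by (auto simp: L_def subspace_def inner_add_right)
  \<comment> \<open>The optimality condition on the affine hull of the face with active set \<open>I\<close>; it makes \<open>\<alpha> p\<close> vary
    with \<open>z\<close> as the projection of \<open>z\<close> onto the orthogonal complement of \<open>fst ` L I\<close>.\<close>
  define R where "R I z p \<longleftrightarrow>
      (\<exists>r. \<forall>H\<in>I. n H \<bullet> (z - \<alpha> *\<^sub>R p, r) = b H) \<and> (\<forall>v\<in>L I. (p, -1) \<bullet> v = 0)" for I z p
  have piece: "\<exists>A c. linear A \<and> (\<forall>u. 0 \<le> u \<bullet> A u) \<and> (\<forall>z p. R I z p \<longrightarrow> p = A z + c)" for I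
  proof (cases "\<exists>z p. R I z p")
    \<comment> \<open>A set of constraints realised by no pair gets the zero map as a
      default.\<close>
    case False
    then show ?thesis
      by (intro exI[of _ "\<lambda>_. 0"]) (auto simp: linear_zero)
  next
    case True
    then obtain z0 p0 where R0: "R I z0 p0" by blast
    then obtain r0 where r0: "\<And>H. H \<in> I \<Longrightarrow> n H \<bullet> (z0 - \<alpha> *\<^sub>R p0, r0) = b H"
      unfolding R_def by blast
    have "subspace (fst ` L I)"
      by (rule linear_subspace_image[OF linear_fst subsp_L])
    then obtain Q where Q: "linear Q" "\<And>u. 0 \<le> u \<bullet> Q u"
      "\<And>u q. \<lbrakk>u \<in> fst ` L I; \<And>w. w \<in> fst ` L I \<Longrightarrow> q \<bullet> w = 0\<rbrakk> \<Longrightarrow> Q (u + q) = q"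
      by (rule subspace_orthogonal_complement_projection) blast
    have "p = (1/\<alpha>) *\<^sub>R Q z + (p0 - (1/\<alpha>) *\<^sub>R Q z0)" if "R I z p" for z p
    proof -
      obtain r where r: "\<And>H. H \<in> I \<Longrightarrow> n H \<bullet> (z - \<alpha> *\<^sub>R p, r) = b H"
        using \<open>R I z p\<close> unfolding R_def by blast
      have "(z - \<alpha> *\<^sub>R p, r) - (z0 - \<alpha> *\<^sub>R p0, r0) \<in> L I"
        unfolding L_def using r r0 by (auto simp only: mem_Collect_eq inner_diff_right)
      then have "(z - \<alpha> *\<^sub>R p) - (z0 - \<alpha> *\<^sub>R p0) \<in> fst ` L I"
        by (force simp: image_iff)
      \<comment> \<open>On \<open>L I\<close> both \<open>p\<close> and \<open>p0\<close> turn the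
        first component into the second, so their difference annihilates the first component. Hence
        \<open>z - z0\<close> splits into a part in the projected subspace and the orthogonal part
        \<open>\<alpha> *\<^sub>R (p - p0)\<close>.\<close>
      moreover have "(\<alpha> *\<^sub>R (p - p0)) \<bullet> w = 0" if "w \<in> fst ` L I" for w
        using that R0 \<open>R I z p\<close> by (force simp: R_def inner_diff_left)
      ultimately have "Q ((z - \<alpha> *\<^sub>R p) - (z0 - \<alpha> *\<^sub>R p0) + \<alpha> *\<^sub>R (p - p0)) = \<alpha> *\<^sub>R (p - p0)"
        by (rule Q(3))
      then have "Q z - Q z0 = \<alpha> *\<^sub>R (p - p0)"
        by (simp add: linear_diff[OF Q(1), symmetric] algebra_simps)
      then have "(1/\<alpha>) *\<^sub>R (Q z - Q z0) = p - p0"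
        using assms(2) by simp
      then show ?thesis by (simp add: algebra_simps)
    qed
    moreover have "linear (\<lambda>z. (1/\<alpha>) *\<^sub>R Q z)"
      using Q(1) by (intro linear_compose_scale_right)
    ultimately show ?thesis
      using Q(2) assms(2)
      by (intro exI[of _ "\<lambda>z. (1/\<alpha>) *\<^sub>R Q z"] exI[of _ "p0 - (1/\<alpha>) *\<^sub>R Q z0"]) auto
  qed
  then obtain A c where Ac: "\<And>I. linear (A I)" "\<And>I u. 0 \<le> u \<bullet> A I u"
      "\<And>I z p. R I z p \<Longrightarrow> p = A I z + c I"
    by metis
  show thesis
  proof
    show "finite ((\<lambda>I. (A I, c I)) ` Pow F)"
      using F(1) by simp
    show "linear A' \<and> (\<forall>u. 0 \<le> u \<bullet> A' u)" if "(A', b') \<in> (\<lambda>I. (A I, c I)) ` Pow F" for A' b'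
      using that Ac(1,2) by auto
    fix z p assume "epi_subgrad E (z - \<alpha> *\<^sub>R p) p"
    then obtain r where r: "(z - \<alpha> *\<^sub>R p, r) \<in> E"
      "\<And>w t. (w, t) \<in> E \<Longrightarrow> r + p \<bullet> (w - (z - \<alpha> *\<^sub>R p)) \<le> t"
      unfolding epi_subgrad_def by blast
    let ?x = "(z - \<alpha> *\<^sub>R p, r)"
    define I where "I = {H\<in>F. n H \<bullet> ?x = b H}"
    \<comment> \<open>A short step along \<open>v\<close> keeps active constraints tight and
      inactive ones satisfied, so it stays in \<open>E\<close> and the subgradient inequality
      applies. Since \<open>L I\<close> also contains \<open>-v\<close>, the inequality becomes an
      equality below.\<close>
    have nonneg: "(p, -1) \<bullet> v \<le> 0" if "v \<in> L I" for v
    proof -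
      have "\<forall>\<^sub>F \<epsilon> in at_right (0::real). n H \<bullet> (?x + \<epsilon> *\<^sub>R v) \<le> b H" if "H \<in> F" for H
      proof (cases "H \<in> I")
        case True
        then show ?thesis
          using \<open>v \<in> L I\<close> by (simp add: I_def L_def inner_add_right)
      next
        case False
        then have "n H \<bullet> ?x < b H"
          using r(1) that by (force simp: I_def E_iff)
        moreover have "((\<lambda>\<epsilon>. n H \<bullet> (?x + \<epsilon> *\<^sub>R v)) \<longlongrightarrow> n H \<bullet> (?x + 0 *\<^sub>R v)) (at_right 0)"
          by (intro tendsto_intros)
        ultimately have "\<forall>\<^sub>F \<epsilon> in at_right 0. n H \<bullet> (?x + \<epsilon> *\<^sub>R v) < b H"
          by (intro order_tendstoD(2)) auto
        then show ?thesis by eventually_elim simp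
      qed
      then have "\<forall>\<^sub>F \<epsilon> in at_right (0::real). \<forall>H\<in>F. n H \<bullet> (?x + \<epsilon> *\<^sub>R v) \<le> b H"
        using F(1) by (simp add: eventually_ball_finite_distrib)
      then have "\<forall>\<^sub>F \<epsilon> in at_right (0::real). ?x + \<epsilon> *\<^sub>R v \<in> E \<and> \<epsilon> > 0"
        using eventually_at_right_less[of "0::real"] by eventually_elim (simp add: E_iff)
      then obtain \<epsilon> where \<epsilon>: "?x + \<epsilon> *\<^sub>R v \<in> E" "\<epsilon> > 0"
        using eventually_happens[of _ "at_right (0::real)"] by (force simp: trivial_limit_at_right_real)
      obtain v1 v2 where v: "v = (v1, v2)" by (cases v)
      have "\<epsilon> * (p \<bullet> v1 - v2) \<le> 0"
        using r(2)[of "z - \<alpha> *\<^sub>R p + \<epsilon> *\<^sub>R v1" "r + \<epsilon> * v2"] \<epsilon> by (simp add: v algebra_simps)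
      then show ?thesis using \<epsilon>(2) by (simp add: v mult_le_0_iff)
    qed
    have "(p, -1) \<bullet> v = 0" if "v \<in> L I" for v
      using nonneg[OF that] nonneg[OF subspace_neg[OF subsp_L that]] by simp
    then have "R I z p"
      unfolding R_def I_def by blast
    moreover have "I \<in> Pow F" by (auto simp: I_def)
    ultimately show "\<exists>(A', b')\<in>(\<lambda>I. (A I, c I)) ` Pow F. p = A' z + b'"
      using Ac(3) by blast
  qed
qed

section \<open>Implicit functions\<close>

text \<open>In finite dimension, continuity of the derivative in each fixed direction implies
  continuity in operator norm.\<close>

lemma C1_onI:
  fixes f :: "'a::euclidean_space \<Rightarrow> 'b::real_normed_vector"
  assumes "\<And>x. x \<in> U \<Longrightarrow> (f has_derivative D x) (at x)"
    and "\<And>v. continuous_on U (\<lambda>x. D x v)"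
  shows "C1_on U f"
proof -
  have D: "blinfun_apply (Blinfun (D x)) = D x" if "x \<in> U" for x
    using has_derivative_bounded_linear[OF assms(1)[OF that]] by (rule bounded_linear_Blinfun_apply)
  have "continuous_on U (\<lambda>x. Blinfun (D x))"
  proof (rule continuous_on_blinfun_componentwise)
    show "continuous_on U (\<lambda>x. blinfun_apply (Blinfun (D x)) v)" for v
      using assms(2)[of v] by (rule continuous_on_eq) (simp add: D)
  qed
  then show ?thesis
    unfolding C1_on_def using assms(1) D by (intro exI[of _ "\<lambda>x. Blinfun (D x)"]) simp
qed

lemma C1_on_subset: "\<lbrakk>C1_on U f; V \<subseteq> U\<rbrakk> \<Longrightarrow> C1_on V f"
  unfolding C1_on_def by (meson continuous_on_subset subsetD)

text \<open>A perturbation estimate: \<open>T y0\<close> is bounded below by some \<open>B\<close>,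
  and once \<open>T y\<close> is within \<open>B / 2\<close> of it, the error term containing
  \<open>w y - w y0\<close> is absorbed on the left. This makes the derivative of a local inverse
  continuous.\<close>

lemma continuous_on_inv_blinfun:
  fixes T :: "'a::metric_space \<Rightarrow> 'b::euclidean_space \<Rightarrow>\<^sub>L 'b"
  assumes cont: "continuous_on V T" and bij: "\<And>y. y \<in> V \<Longrightarrow> bij (blinfun_apply (T y))"
  shows "continuous_on V (\<lambda>y. inv (blinfun_apply (T y)) v)"
  unfolding continuous_on_def
proof
  fix y0 assume y0: "y0 \<in> V"
  define w where "w y = inv (blinfun_apply (T y)) v" for y
  have Tw: "T y (w y) = v" if "y \<in> V" for y
    unfolding w_def by (rule surj_f_inv_f[OF bij_is_surj[OF bij[OF that]]])
  have "linear (blinfun_apply (T y0))"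
    by (intro bounded_linear.linear blinfun.bounded_linear_right)
  then obtain B where B: "B > 0" "\<And>x. B * norm x \<le> norm (T y0 x)"
    using linear_inj_bounded_below_pos bij_is_inj[OF bij[OF y0]] by blast
  have lim: "((\<lambda>y. norm (T y - T y0)) \<longlongrightarrow> 0) (at y0 within V)"
    using cont y0 unfolding continuous_on_def by (intro tendsto_norm_zero LIM_zero) blast
  have "\<forall>\<^sub>F y in at y0 within V. norm (w y - w y0) \<le> (2 / B) * (norm (T y - T y0) * norm (w y0))"
  proof -
    have "\<forall>\<^sub>F y in at y0 within V. norm (T y - T y0) < B / 2"
      using B(1) by (intro order_tendstoD(2)[OF lim]) simp
    moreover have "\<forall>\<^sub>F y in at y0 within V. y \<in> V"
      by (simp add: eventually_at_filter)
    ultimately show ?thesis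
    proof eventually_elim
      case (elim y)
      have "T y0 (w y - w y0) = - (T y - T y0) (w y - w y0) - (T y - T y0) (w y0)"
        using Tw[OF elim(2)] Tw[OF y0] by (simp add: blinfun.bilinear_simps)
      then have "B * norm (w y - w y0) \<le>
          norm (- (T y - T y0) (w y - w y0) - (T y - T y0) (w y0))"
        using B(2)[of "w y - w y0"] by simp
      also have "\<dots> \<le> norm ((T y - T y0) (w y - w y0)) + norm ((T y - T y0) (w y0))"
        using norm_triangle_ineq4[of "- (T y - T y0) (w y - w y0)" "(T y - T y0) (w y0)"]
        by (simp only: norm_minus_cancel)
      also have "\<dots> \<le> norm (T y - T y0) * norm (w y - w y0) + norm (T y - T y0) * norm (w y0)"
        by (intro add_mono norm_blinfun)
      also have "\<dots> \<le> B / 2 * norm (w y - w y0) + norm (T y - T y0) * norm (w y0)"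
        using elim(1) by (intro add_right_mono mult_right_mono) auto
      finally show ?case using B(1) by (simp add: field_simps)
    qed
  qed
  moreover have "((\<lambda>y. (2 / B) * (norm (T y - T y0) * norm (w y0))) \<longlongrightarrow> 0) (at y0 within V)"
    using tendsto_mult_right_zero[OF tendsto_mult_left_zero[OF lim]] .
  ultimately have "((\<lambda>y. w y - w y0) \<longlongrightarrow> 0) (at y0 within V)"
    by (rule Lim_null_comparison)
  then show "((\<lambda>y. inv (blinfun_apply (T y)) v) \<longlongrightarrow> inv (blinfun_apply (T y0)) v) (at y0 within V)"
    unfolding w_def by (rule LIM_zero_cancel)
qed

text \<open>The inverse function theorem is applied to \<open>\<Theta>\<close>, which keeps
  \<open>x\<close> and replaces \<open>v\<close> by \<open>H (x, v)\<close>. Its derivative is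
  injective, hence invertible in finite dimension. Only the uniqueness half is recorded: existing
  zeros in \<open>W\<close> lie on the graph of \<open>\<phi>\<close>.\<close>

lemma implicit_function_C1:
  fixes H :: "'a::euclidean_space \<times> 'b::euclidean_space \<Rightarrow> 'b"
  assumes C1: "C1_on UNIV H"
    and zero: "H (x0, v0) = 0"
    and der0: "(H has_derivative D) (at (x0, v0))"
    and inj0: "\<And>v. D (0, v) = 0 \<Longrightarrow> v = 0"
  obtains U W \<phi> where "open U" "x0 \<in> U" "open W" "(x0, v0) \<in> W" "C1_on U \<phi>"
    "\<And>x v. \<lbrakk>(x, v) \<in> W; H (x, v) = 0\<rbrakk> \<Longrightarrow> v = \<phi> x"
proof -
  obtain H' where der: "\<And>z. (H has_derivative blinfun_apply (H' z)) (at z)"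
    and cont: "continuous_on UNIV H'"
    using C1 unfolding C1_on_def by auto
  have "blinfun_apply (H' (x0, v0)) = D"
    using der der0 by (rule has_derivative_unique)
  then have inj: "v = 0" if "H' (x0, v0) (0, v) = 0" for v
    using inj0 that by simp
  define \<Theta> where "\<Theta> z = (fst z, H z)" for z
  define \<Theta>' where "\<Theta>' z = Blinfun (\<lambda>u. (fst u, H' z u))" for z
  have \<Theta>': "blinfun_apply (\<Theta>' z) = (\<lambda>u. (fst u, H' z u))" for z
    unfolding \<Theta>'_def
    by (intro bounded_linear_Blinfun_apply bounded_linear_Pair bounded_linear_fst blinfun.bounded_linear_right)
  have lin: "linear (blinfun_apply (\<Theta>' (x0, v0)))"
    by (intro bounded_linear.linear blinfun.bounded_linear_right)
  have "inj (blinfun_apply (\<Theta>' (x0, v0)))"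
  proof (subst linear_injective_0[OF lin])
    show "\<forall>u. \<Theta>' (x0, v0) u = 0 \<longrightarrow> u = 0"
      unfolding \<Theta>' using inj by (auto simp: zero_prod_def)
  qed
  then obtain T where T: "linear T" "T \<circ> blinfun_apply (\<Theta>' (x0, v0)) = id"
    using linear_injective_left_inverse[OF lin] by blast
  have "bounded_linear T" using T(1) by (simp add: linear_conv_bounded_linear)
  then have inv: "Blinfun T o\<^sub>L \<Theta>' (x0, v0) = id_blinfun"
    using pointfree_idE[OF T(2)] by (intro blinfun_eqI) (simp add: bounded_linear_Blinfun_apply)
  have der\<Theta>: "(\<Theta> has_derivative blinfun_apply (\<Theta>' z)) (at z)" for z
    unfolding \<Theta>' \<Theta>_def using der[of z] by (auto intro!: derivative_eq_intros)
  have cont\<Theta>: "continuous_on UNIV \<Theta>'"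
  proof (rule continuous_on_blinfun_componentwise)
    show "continuous_on UNIV (\<lambda>z. blinfun_apply (\<Theta>' z) u)" for u
      unfolding \<Theta>' using cont by (intro continuous_intros)
  qed
  obtain W V g g' where W: "open W" "W \<subseteq> UNIV" "(x0, v0) \<in> W"
    and V: "open V" "\<Theta> (x0, v0) \<in> V" and hom: "homeomorphism W V \<Theta> g"
    and g: "\<And>y. y \<in> V \<Longrightarrow> (g has_derivative g' y) (at y)"
      "\<And>y. y \<in> V \<Longrightarrow> g' y = inv (blinfun_apply (\<Theta>' (g y)))"
      "\<And>y. y \<in> V \<Longrightarrow> bij (blinfun_apply (\<Theta>' (g y)))"
    by (rule inverse_function_theorem[OF open_UNIV der\<Theta> cont\<Theta> UNIV_I inv]) (rule that)
  \<comment> \<open>Zeros of \<open>H\<close> are the points that \<open>\<Theta>\<close> sends to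
    second coordinate 0, so the local inverse is restricted to that slice.\<close>
  define U where "U = (\<lambda>x. (x, 0)) -` V"
  define \<phi> where "\<phi> x = snd (g (x, 0))" for x
  have "continuous_on V g"
    using hom by (simp add: homeomorphism_def)
  then have "continuous_on V (\<lambda>y. \<Theta>' (g y))"
    by (rule continuous_on_compose2[OF cont\<Theta>]) simp
  then have cont_inv: "continuous_on V (\<lambda>y. inv (blinfun_apply (\<Theta>' (g y))) u)" for u
    using g(3) by (rule continuous_on_inv_blinfun)
  have cont_g': "continuous_on V (\<lambda>y. g' y u)" for u
    using cont_inv[of u] by (rule continuous_on_eq) (simp add: g(2))
  show thesis
  proof
    show "open U"
      unfolding U_def by (intro open_vimage V continuous_intros)
    show "x0 \<in> U"
      using V(2) zero by (simp add: U_def \<Theta>_def)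
    show "C1_on U \<phi>"
    proof (rule C1_onI)
      show "(\<phi> has_derivative (\<lambda>u. snd (g' (x, 0) (u, 0)))) (at x)" if "x \<in> U" for x
      proof -
        have "((\<lambda>x. (x, 0)) has_derivative (\<lambda>u. (u, 0))) (at x)"
          by (auto intro!: derivative_eq_intros)
        from has_derivative_compose[OF this, of g "g' (x, 0)"] g(1)[of "(x, 0)"] that
        show ?thesis unfolding \<phi>_def
          by (intro has_derivative_snd) (simp add: U_def)
      qed
      show "continuous_on U (\<lambda>x. snd (g' (x, 0) (u, 0)))" for u
        by (intro continuous_on_snd continuous_on_compose2[OF cont_g'] continuous_intros)
          (auto simp: U_def)
    qed
    show "v = \<phi> x" if "(x, v) \<in> W" "H (x, v) = 0" for x v
      using homeomorphism_apply1[OF hom that(1)] that(2) by (simp add: \<Theta>_def \<phi>_def)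
  qed (use W in auto)
qed

section \<open>Convex functions\<close>

text \<open>Restriction to the line through \<open>x\<close> and \<open>y\<close> reduces this to
  the one-variable tangent inequality.\<close>

lemma convex_on_above_tangent:
  fixes f :: "'a::real_normed_vector \<Rightarrow> real"
  assumes "convex_on UNIV f" "(f has_derivative f') (at x)"
  shows "f x + f' (y - x) \<le> f y"
proof -
  define \<phi> where "\<phi> t = f (x + t *\<^sub>R (y - x))" for t
  have "convex_on UNIV \<phi>"
  proof (rule convex_onI)
    fix t s r :: real assume "0 < t" "t < 1"
    have "\<phi> ((1 - t) *\<^sub>R s + t *\<^sub>R r) =
        f ((1 - t) *\<^sub>R (x + s *\<^sub>R (y - x)) + t *\<^sub>R (x + r *\<^sub>R (y - x)))"
      unfolding \<phi>_def by (rule arg_cong[where f = f]) (simp add: algebra_simps)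
    then show "\<phi> ((1 - t) *\<^sub>R s + t *\<^sub>R r) \<le> (1 - t) * \<phi> s + t * \<phi> r"
      using convex_onD[OF assms(1)] \<open>0 < t\<close> \<open>t < 1\<close> by (simp add: \<phi>_def)
  qed simp
  moreover have "(\<phi> has_real_derivative f' (y - x)) (at 0)"
  proof -
    have "((\<lambda>t. x + t *\<^sub>R (y - x)) has_derivative (\<lambda>t. t *\<^sub>R (y - x))) (at 0)"
      by (auto intro!: derivative_eq_intros)
    from has_derivative_compose[OF this, of f f'] assms(2)
    have "(\<phi> has_derivative (\<lambda>t. f' (t *\<^sub>R (y - x)))) (at 0)"
      by (simp add: \<phi>_def [abs_def])
    moreover have "(\<lambda>t. f' (t *\<^sub>R (y - x))) = (*) (f' (y - x))"
      using linear_cmul[OF has_derivative_linear[OF assms(2)]] by (auto simp: mult.commute)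
    ultimately show ?thesis by (simp add: has_field_derivative_def)
  qed
  ultimately have "f' (y - x) * (1 - 0) \<le> \<phi> 1 - \<phi> 0"
    by (intro convex_on_imp_above_tangent[of UNIV]) auto
  then show ?thesis by (simp add: \<phi>_def)
qed

text \<open>Adding the tangent inequalities at two points of a line in direction \<open>u\<close>
  shows that the directional derivative increases along it; \<open>D' u\<close> is the slope of that
  increasing function.\<close>

lemma convex_on_second_derivative_nonneg:
  fixes f :: "'a::real_normed_vector \<Rightarrow> real"
  assumes conv: "convex_on UNIV f" and der: "\<And>y. (f has_derivative D y) (at y)"
    and der2: "((\<lambda>y. D y u) has_derivative D') (at y)"
  shows "0 \<le> D' u"
proof (rule mono_on_imp_deriv_nonneg)
  have lin: "linear (D y)" for y
    using der by (rule has_derivative_linear)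
  show "mono_on UNIV (\<lambda>t. D (y + t *\<^sub>R u) u)"
  proof (rule mono_onI)
    fix r s :: real assume "r \<le> s"
    let ?a = "y + r *\<^sub>R u" and ?b = "y + s *\<^sub>R u"
    have "f ?a + (s - r) * D ?a u \<le> f ?b"
      using convex_on_above_tangent[OF conv der, of ?a ?b] linear_cmul[OF lin]
      by (simp flip: scaleR_diff_left)
    moreover have "f ?b + (r - s) * D ?b u \<le> f ?a"
      using convex_on_above_tangent[OF conv der, of ?b ?a] linear_cmul[OF lin]
      by (simp flip: scaleR_diff_left)
    ultimately have "0 \<le> (s - r) * (D ?b u - D ?a u)"
      by (simp add: algebra_simps)
    then show "D ?a u \<le> D ?b u"
      using \<open>r \<le> s\<close> by (cases "r = s") (auto simp: zero_le_mult_iff)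
  qed
  have "((\<lambda>t. y + t *\<^sub>R u) has_derivative (\<lambda>t. t *\<^sub>R u)) (at 0)"
    by (auto intro!: derivative_eq_intros)
  from has_derivative_compose[OF this, of "\<lambda>y. D y u" D'] der2
  have "((\<lambda>t. D (y + t *\<^sub>R u) u) has_derivative (\<lambda>t. D' (t *\<^sub>R u))) (at 0)"
    by simp
  moreover have "(\<lambda>t. D' (t *\<^sub>R u)) = (*) (D' u)"
    using linear_cmul[OF has_derivative_linear[OF der2]] by (auto simp: mult.commute)
  ultimately show "((\<lambda>t. D (y + t *\<^sub>R u) u) has_real_derivative D' u) (at 0)"
    by (simp add: has_field_derivative_def)
qed simp

section \<open>Coercivity of one-variable quadratics\<close>

lemma quadratic_lower_bound:
  fixes k a q :: real
  assumes "k > 0"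
  shows "- (a\<^sup>2 / (4 * k)) \<le> k * q\<^sup>2 - a * q"
proof -
  have "k * q\<^sup>2 - a * q + a\<^sup>2 / (4 * k) = k * (q - a / (2 * k))\<^sup>2"
    using assms by (simp add: power2_eq_square field_simps)
  also have "\<dots> \<ge> 0" using assms by simp
  finally show ?thesis by simp
qed

text \<open>For \<open>q > 1\<close> the constant is at most \<bar>K\<bar> times \<open>q\<close>,
  and one factor \<open>q\<close> cancels; the summand 1 covers the remaining case.\<close>

lemma quadratic_bound:
  fixes k a K q :: real
  assumes "k > 0" "k * q\<^sup>2 - a * q \<le> K"
  shows "q \<le> (\<bar>K\<bar> + \<bar>a\<bar>) / k + 1"
proof (cases "q \<le> 1")
  case True
  then show ?thesis using assms(1) by (smt (verit) divide_nonneg_pos)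
next
  case False
  have "k * q\<^sup>2 \<le> K + a * q" using assms(2) by simp
  also have "\<dots> \<le> \<bar>K\<bar> * q + \<bar>a\<bar> * q"
  proof (rule add_mono)
    show "K \<le> \<bar>K\<bar> * q"
      using False mult_left_mono[of 1 q "\<bar>K\<bar>"] by simp
    show "a * q \<le> \<bar>a\<bar> * q"
      using False by (intro mult_right_mono) auto
  qed
  finally have "(k * q) * q \<le> (\<bar>K\<bar> + \<bar>a\<bar>) * q"
    by (simp add: power2_eq_square algebra_simps)
  then have "k * q \<le> \<bar>K\<bar> + \<bar>a\<bar>" using False by simp
  then have "q \<le> (\<bar>K\<bar> + \<bar>a\<bar>) / k" using assms(1) by (simp add: field_simps)
  then show ?thesis by simp
qed

section \<open>The regularised system\<close>

text \<open>The function \<open>h\<close> is represented by its epigraph \<open>E\<close>, and its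
  monotonicity enters only through \<open>G_convex\<close>. The maps \<open>g'\<close> and
  \<open>G'\<close> are total derivatives; directions \<open>(0, u)\<close> give the partial ones in
  \<open>y\<close>.\<close>

locale regularized_system =
  fixes g :: "'a::euclidean_space \<times> 'b::euclidean_space \<Rightarrow> real"
    and G :: "'a \<times> 'b \<Rightarrow> 'c::euclidean_space"
    and g' :: "'a \<times> 'b \<Rightarrow> ('a \<times> 'b) \<Rightarrow>\<^sub>L real"
    and G' :: "'a \<times> 'b \<Rightarrow> ('a \<times> 'b) \<Rightarrow>\<^sub>L 'c"
    and E :: "('c \<times> real) set"
    and \<alpha> \<beta> :: real
  assumes g_der: "\<And>z. (g has_derivative blinfun_apply (g' z)) (at z)"
    and G_der: "\<And>z. (G has_derivative blinfun_apply (G' z)) (at z)"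
    and g'_C1: "C1_on UNIV g'"
    and G'_C1: "C1_on UNIV G'"
    and g_convex: "\<And>x. convex_on UNIV (\<lambda>y. g (x, y))"
    and G_convex: "\<And>v p x. epi_subgrad E v p \<Longrightarrow> convex_on UNIV (\<lambda>y. p \<bullet> G (x, y))"
    and E_poly: "polyhedron E"
    and E_subgrad: "\<exists>v p. epi_subgrad E v p"
    and \<alpha>: "\<alpha> > 0" and \<beta>: "\<beta> > 0"
begin

text \<open>Testing the stationarity equation in every direction avoids adjoints, and the inclusion
  is stated in its dual form, on the side of \<open>h\<close>.\<close>

definition sol :: "'a \<Rightarrow> 'b \<Rightarrow> 'c \<Rightarrow> bool" where
  "sol x y p \<longleftrightarrow>
     (\<forall>u. g' (x, y) (0, u) + p \<bullet> G' (x, y) (0, u) + \<beta> * (y \<bullet> u) = 0) \<and>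
     epi_subgrad E (G (x, y) - \<alpha> *\<^sub>R p) p"

section \<open>Derivatives, continuity and tangent inequalities of the data\<close>

lemma pair_der: "((\<lambda>y. (x, y)) has_derivative (\<lambda>u. (0, u))) (at y)"
  by (auto intro!: derivative_eq_intros)

lemma g_partial_der: "((\<lambda>y. g (x, y)) has_derivative (\<lambda>u. g' (x, y) (0, u))) (at y)"
  using has_derivative_compose[OF pair_der g_der] by simp

lemma G_partial_der: "((\<lambda>y. G (x, y)) has_derivative (\<lambda>u. G' (x, y) (0, u))) (at y)"
  using has_derivative_compose[OF pair_der G_der] by simp

lemma continuous_g: "continuous_on S g"
  using g_der by (intro continuous_at_imp_continuous_on ballI has_derivative_continuous)

lemma continuous_G: "continuous_on S G"
  using G_der by (intro continuous_at_imp_continuous_on ballI has_derivative_continuous)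

lemma continuous_g': "continuous_on S g'"
proof -
  obtain D where "\<And>z. (g' has_derivative blinfun_apply (D z)) (at z)"
    using g'_C1 unfolding C1_on_def by auto
  then show ?thesis
    by (intro continuous_at_imp_continuous_on ballI has_derivative_continuous)
qed

lemma continuous_G': "continuous_on S G'"
proof -
  obtain D where "\<And>z. (G' has_derivative blinfun_apply (D z)) (at z)"
    using G'_C1 unfolding C1_on_def by auto
  then show ?thesis
    by (intro continuous_at_imp_continuous_on ballI has_derivative_continuous)
qed

lemma g_tangent: "g (x, y) + g' (x, y) (0, y' - y) \<le> g (x, y')"
  using convex_on_above_tangent[OF g_convex g_partial_der] .

lemma G_tangent:
  assumes "epi_subgrad E v p"
  shows "p \<bullet> G (x, y) + p \<bullet> G' (x, y) (0, y' - y) \<le> p \<bullet> G (x, y')"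
proof -
  have "((\<lambda>y. p \<bullet> G (x, y)) has_derivative (\<lambda>u. p \<bullet> G' (x, y) (0, u))) (at y)"
    using G_partial_der by (rule has_derivative_inner_right)
  then show ?thesis
    using convex_on_above_tangent[OF G_convex[OF assms]] by fastforce
qed

text \<open>Monotonicity of subgradients bounds the change of \<open>p\<close> (fact 1), convexity
  and stationarity bound the change of \<open>y\<close> (fact 2). The product of the change of
  \<open>p\<close> with \<open>G (x, y) - G (x, y0)\<close> enters with opposite signs and cancels
  in the sum.\<close>

lemma sol_stable:
  assumes "sol x y p" "sol x0 y0 p0"
  shows "norm (y - y0) + norm (p - p0) \<le>
    2 / min \<alpha> \<beta> * (norm (G (x, y0) - G (x0, y0)) + norm (g' (x, y0) - g' (x0, y0)) +
      norm p0 * norm (G' (x, y0) - G' (x0, y0)))"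
proof -
  define d where "d = G (x, y0) - G (x0, y0)"
  define e where "e = g' (x, y0) - g' (x0, y0)"
  define e' where "e' = G' (x, y0) - G' (x0, y0)"
  let ?u = "y - y0" and ?q = "p - p0"
  have sg: "epi_subgrad E (G (x, y) - \<alpha> *\<^sub>R p) p" "epi_subgrad E (G (x0, y0) - \<alpha> *\<^sub>R p0) p0"
    using assms by (auto simp: sol_def)
  have "0 \<le> ?q \<bullet> (G (x, y) - \<alpha> *\<^sub>R p - (G (x0, y0) - \<alpha> *\<^sub>R p0))"
    using sg by (rule epi_subgrad_monotone)
  then have 1: "\<alpha> * (?q \<bullet> ?q) \<le> ?q \<bullet> (G (x, y) - G (x, y0)) + ?q \<bullet> d"
    by (simp add: d_def algebra_simps inner_commute)
  have neg: "g' (x, y) (0, y0 - y) = - g' (x, y) (0, ?u)"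
    "G' (x, y) (0, y0 - y) = - G' (x, y) (0, ?u)"
    using blinfun.minus_right[of _ "(0, ?u)"] by simp_all
  have eq: "g' (x, y) (0, ?u) + p \<bullet> G' (x, y) (0, ?u) + \<beta> * (y \<bullet> ?u) = 0"
    "g' (x0, y0) (0, ?u) + p0 \<bullet> G' (x0, y0) (0, ?u) + \<beta> * (y0 \<bullet> ?u) = 0"
    using assms unfolding sol_def by blast+
  have expand: "\<beta> * (?u \<bullet> ?u) = \<beta> * (y \<bullet> ?u) - \<beta> * (y0 \<bullet> ?u)"
    "?q \<bullet> (G (x, y) - G (x, y0)) = p \<bullet> G (x, y) - p \<bullet> G (x, y0) - p0 \<bullet> G (x, y) + p0 \<bullet> G (x, y0)"
    "e (0, ?u) = g' (x, y0) (0, ?u) - g' (x0, y0) (0, ?u)"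
    "p0 \<bullet> e' (0, ?u) = p0 \<bullet> G' (x, y0) (0, ?u) - p0 \<bullet> G' (x0, y0) (0, ?u)"
    by (simp_all add: e_def e'_def blinfun.diff_left inner_diff_left inner_diff_right right_diff_distrib)
  \<comment> \<open>Tangents are taken at both \<open>y\<close> and \<open>y0\<close>, all with the
    parameter \<open>x\<close>; passing from \<open>x\<close> to \<open>x0\<close> in the
    stationarity equation at \<open>y0\<close> is what produces \<open>e\<close> and
    \<open>e'\<close>.\<close>
  have "g (x, y) - g' (x, y) (0, ?u) \<le> g (x, y0)"
    using g_tangent[of x y y0] by (simp add: neg)
  moreover have "p \<bullet> G (x, y) - p \<bullet> G' (x, y) (0, ?u) \<le> p \<bullet> G (x, y0)"
    using G_tangent[OF sg(1), of x y y0] by (simp add: neg)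
  moreover note g_tangent[of x y0 y] G_tangent[OF sg(2), of x y0 y]
  ultimately have 2: "\<beta> * (?u \<bullet> ?u) \<le> - (?q \<bullet> (G (x, y) - G (x, y0))) - e (0, ?u) - p0 \<bullet> e' (0, ?u)"
    using eq expand by linarith
  define c where "c = min \<alpha> \<beta>"
  have "c > 0" using \<alpha> \<beta> by (simp add: c_def)
  define N where "N = norm d + norm e + norm p0 * norm e'"
  define R where "R = norm ?u + norm ?q"
  have norm0: "norm (0::'a, ?u) = norm ?u"
    by (simp add: norm_Pair)
  have d_le: "?q \<bullet> d \<le> norm d * norm ?q"
    using norm_cauchy_schwarz[of ?q d] by (simp add: mult.commute)
  have e_le: "- e (0, ?u) \<le> norm e * norm ?u"
    using norm_blinfun[of e "(0, ?u)"] by (simp add: norm0)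
  have e'_le: "- (p0 \<bullet> e' (0, ?u)) \<le> norm p0 * norm e' * norm ?u"
  proof -
    have "- (p0 \<bullet> e' (0, ?u)) \<le> norm p0 * norm (e' (0, ?u))"
      using norm_cauchy_schwarz[of "- p0" "e' (0, ?u)"] by simp
    also have "\<dots> \<le> norm p0 * (norm e' * norm ?u)"
      using norm_blinfun[of e' "(0, ?u)"] by (intro mult_left_mono) (simp_all add: norm0)
    finally show ?thesis by (simp add: mult.assoc)
  qed
  have "c / 2 * R\<^sup>2 \<le> c * (norm ?u)\<^sup>2 + c * (norm ?q)\<^sup>2"
    using \<open>c > 0\<close> mult_left_mono[OF sum_squares_bound[of "norm ?u" "norm ?q"], of c]
    by (simp add: R_def power2_sum algebra_simps)
  also have "\<dots> \<le> \<beta> * (norm ?u)\<^sup>2 + \<alpha> * (norm ?q)\<^sup>2"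
    by (intro add_mono mult_right_mono) (auto simp: c_def)
  also have "\<dots> \<le> norm d * norm ?q + norm e * norm ?u + norm p0 * norm e' * norm ?u"
    using 1 2 d_le e_le e'_le by (simp add: power2_norm_eq_inner)
  also have "\<dots> \<le> N * R"
    by (simp add: N_def R_def algebra_simps)
  finally have "c / 2 * R * R \<le> N * R"
    by (simp add: power2_eq_square mult.assoc)
  moreover have "R \<ge> 0" "N \<ge> 0" by (auto simp: R_def N_def)
  ultimately have "c / 2 * R \<le> N"
    by (cases "R = 0") auto
  then have "R \<le> 2 / c * N"
    using \<open>c > 0\<close> by (simp add: field_simps)
  then show ?thesis
    by (simp add: R_def N_def c_def d_def e_def e'_def)
qed

lemma sol_unique:
  assumes "sol x y p" "sol x y' p'"
  shows "y = y' \<and> p = p'"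
proof -
  have "norm (y - y') + norm (p - p') \<le> 0"
    using sol_stable[OF assms] by simp
  then show ?thesis
    by (smt (verit) norm_ge_zero norm_eq_zero right_minus_eq)
qed

text \<open>The direct method: \<open>lower\<close> confines every competitor below the level
  \<open>M\<close> to a compact set, so a minimiser of \<open>\<Psi>\<close> exists. Varying
  \<open>y\<close> alone gives stationarity, varying \<open>(w, t)\<close> alone gives the
  subgradient inequality.\<close>

lemma sol_exists: "\<exists>y p. sol x y p"
proof -
  obtain v0 r0 p0 where r0: "(v0, r0) \<in> E" "epi_subgrad E v0 p0"
      "\<And>w t. (w, t) \<in> E \<Longrightarrow> r0 + p0 \<bullet> (w - v0) \<le> t"
    using E_subgrad unfolding epi_subgrad_def by blast
  define \<Psi> where "\<Psi> = (\<lambda>(y, w, t).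
      g (x, y) + t + (norm (G (x, y) - w))\<^sup>2 / (2 * \<alpha>) + \<beta> / 2 * (norm y)\<^sup>2)"
  define M where "M = \<Psi> (0, v0, r0)"
  define a1 where "a1 = norm (g' (x, 0))"
  define a2 where "a2 = norm p0 * norm (G' (x, 0))"
  define C where "C = g (x, 0) + r0 - p0 \<bullet> v0 + p0 \<bullet> G (x, 0)"
  have g_lower: "g (x, 0) - a1 * norm y \<le> g (x, y)" for y
  proof -
    have "- g' (x, 0) (0, y) \<le> a1 * norm y"
      using norm_blinfun[of "g' (x, 0)" "(0, y)"] by (simp add: a1_def norm_Pair)
    then show ?thesis using g_tangent[of x 0 y] by simp
  qed
  have pG_lower: "p0 \<bullet> G (x, 0) - a2 * norm y \<le> p0 \<bullet> G (x, y)" for y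
  proof -
    have "- (p0 \<bullet> G' (x, 0) (0, y)) \<le> norm p0 * norm (G' (x, 0) (0, y))"
      using norm_cauchy_schwarz[of "- p0" "G' (x, 0) (0, y)"] by simp
    also have "\<dots> \<le> norm p0 * (norm (G' (x, 0)) * norm y)"
      using norm_blinfun[of "G' (x, 0)" "(0, y)"] by (intro mult_left_mono) (simp_all add: norm_Pair)
    finally show ?thesis using G_tangent[OF r0(2), of x 0 y] by (simp add: a2_def mult.assoc)
  qed
  define q1 where "q1 y = \<beta> / 2 * (norm y)\<^sup>2 - (a1 + a2) * norm y" for y :: 'b
  define q2 where "q2 s = 1 / (2 * \<alpha>) * s\<^sup>2 - norm p0 * s" for s :: real
  \<comment> \<open>The affine minorant bounds \<open>t\<close> below by
    \<open>p0 \<bullet> w\<close> up to constants. Writing \<open>w\<close> as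
    \<open>G (x, y)\<close> minus the residual leaves losses linear in the norms of \<open>y\<close>
    and of the residual, which the quadratic terms dominate.\<close>
  have lower: "C + q1 y + q2 (norm (G (x, y) - w)) \<le> \<Psi> (y, w, t)" if "(w, t) \<in> E" for y w t
  proof -
    have "p0 \<bullet> G (x, y) - p0 \<bullet> w \<le> norm p0 * norm (G (x, y) - w)"
      using norm_cauchy_schwarz[of p0 "G (x, y) - w"] by (simp add: inner_diff_right)
    then show ?thesis
      using r0(3)[OF that] g_lower[of y] pG_lower[of y]
      by (simp add: \<Psi>_def C_def q1_def q2_def inner_diff_right algebra_simps)
  qed
  obtain Q1 where Q1: "\<And>y. - Q1 \<le> q1 y"
    unfolding q1_def using quadratic_lower_bound[of "\<beta> / 2"] \<beta> half_gt_zero by blast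
  obtain Q2 where Q2: "\<And>s. - Q2 \<le> q2 s"
    unfolding q2_def using quadratic_lower_bound[of "1 / (2 * \<alpha>)"] \<alpha> by fastforce
  \<comment> \<open>Each radius comes from \<open>quadratic_bound\<close> after the other quadratic
    is replaced by its lower bound.\<close>
  define R1 where "R1 = (\<bar>M - C + Q2\<bar> + \<bar>a1 + a2\<bar>) / (\<beta> / 2) + 1"
  define R2 where "R2 = (\<bar>M - C + Q1\<bar> + \<bar>norm p0\<bar>) / (1 / (2 * \<alpha>)) + 1"
  have "continuous_on (cball 0 R1) (\<lambda>y. G (x, y))"
    by (intro continuous_on_compose2[OF continuous_G] continuous_intros) auto
  then have "bounded ((\<lambda>y. G (x, y)) ` cball 0 R1)"
    by (intro compact_imp_bounded compact_continuous_image) auto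
  then obtain R3 where R3: "\<And>y. norm y \<le> R1 \<Longrightarrow> norm (G (x, y)) \<le> R3"
    unfolding bounded_iff by (metis image_eqI mem_cball_0)
  define l where "l = r0 - norm p0 * (R3 + R2 + norm v0)"
  define m where "m = M - g (x, 0) + a1 * R1"
  \<comment> \<open>The lower end \<open>l\<close> comes from the affine minorant, the upper end
    \<open>m\<close> from the level \<open>M\<close> and \<open>g_lower\<close>.\<close>
  define K where "K = cball (0::'b) R1 \<times> (cball (0::'c) (R3 + R2) \<times> {l..m})"
  have in_K: "(y, w, t) \<in> K" if "(w, t) \<in> E" "\<Psi> (y, w, t) \<le> M" for y w t
  proof -
    have y: "norm y \<le> R1"
      unfolding R1_def using \<beta> lower[OF that(1), of y] that(2) Q2[of "norm (G (x, y) - w)"]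
      by (intro quadratic_bound) (auto simp: q1_def)
    have s: "norm (G (x, y) - w) \<le> R2"
      unfolding R2_def using \<alpha> lower[OF that(1), of y] that(2) Q1[of y]
      by (intro quadratic_bound) (auto simp: q2_def)
    have w: "norm w \<le> R3 + R2"
      using norm_triangle_sub[of w "G (x, y)"] R3[OF y] s by (simp add: norm_minus_commute)
    have "t \<le> M - g (x, y)"
    proof -
      have "0 \<le> (norm (G (x, y) - w))\<^sup>2 / (2 * \<alpha>) + \<beta> / 2 * (norm y)\<^sup>2"
        using \<alpha> \<beta> by simp
      then show ?thesis using that(2) by (simp add: \<Psi>_def)
    qed
    moreover have "a1 * norm y \<le> a1 * R1"
      using y by (intro mult_left_mono) (auto simp: a1_def)
    ultimately have "t \<le> m"
      using g_lower[of y] by (simp add: m_def)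
    moreover have "l \<le> t"
    proof -
      have "- (p0 \<bullet> (w - v0)) \<le> norm p0 * norm (w - v0)"
        using norm_cauchy_schwarz[of "- p0" "w - v0"] by simp
      also have "\<dots> \<le> norm p0 * (R3 + R2 + norm v0)"
        using norm_triangle_ineq4[of w v0] w by (intro mult_left_mono) auto
      finally show ?thesis using r0(3)[OF that(1)] by (simp add: l_def)
    qed
    ultimately show ?thesis using y w by (simp add: K_def)
  qed
  let ?S = "K \<inter> (UNIV \<times> E)"
  have "compact ?S"
    unfolding K_def using E_poly
    by (intro compact_Int_closed compact_Times closed_Times polyhedron_imp_closed) auto
  moreover have base: "(0, v0, r0) \<in> ?S"
    using in_K[OF r0(1), of 0] r0(1) by (simp add: M_def)
  moreover have "continuous_on ?S \<Psi>"
    unfolding \<Psi>_def case_prod_unfold using \<alpha>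
    by (intro continuous_intros continuous_on_compose2[OF continuous_G]
        continuous_on_compose2[OF continuous_g]) auto
  ultimately obtain z where z: "z \<in> ?S" "\<And>z'. z' \<in> ?S \<Longrightarrow> \<Psi> z \<le> \<Psi> z'"
    using continuous_attains_inf[of ?S \<Psi>] by blast
  obtain y w t where ywt: "z = (y, w, t)" by (metis prod.exhaust)
  have wt: "(w, t) \<in> E" using z(1) by (simp add: ywt)
  have min: "\<Psi> (y, w, t) \<le> \<Psi> (y', w', t')" if "(w', t') \<in> E" for y' w' t'
  proof (cases "\<Psi> (y', w', t') \<le> M")
    case True
    then show ?thesis using in_K[OF that True] z(2) that by (simp add: ywt)
  next
    case False
    then show ?thesis using z(2)[OF base] by (simp add: ywt M_def)
  qed
  define p where "p = (1 / \<alpha>) *\<^sub>R (G (x, y) - w)"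
  have w_eq: "w = G (x, y) - \<alpha> *\<^sub>R p"
    using \<alpha> by (simp add: p_def)
  have "((\<lambda>y. g (x, y) + t + ((G (x, y) - w) \<bullet> (G (x, y) - w)) / (2 * \<alpha>) + \<beta> / 2 * (y \<bullet> y))
      has_derivative (\<lambda>u. g' (x, y) (0, u) + p \<bullet> G' (x, y) (0, u) + \<beta> * (y \<bullet> u))) (at y)"
  proof (rule has_derivative_eq_rhs)
    show "((\<lambda>y. g (x, y) + t + ((G (x, y) - w) \<bullet> (G (x, y) - w)) / (2 * \<alpha>) + \<beta> / 2 * (y \<bullet> y))
      has_derivative (\<lambda>u. g' (x, y) (0, u) + 0 + ((G (x, y) - w) \<bullet> (G' (x, y) (0, u) - 0) +
        (G' (x, y) (0, u) - 0) \<bullet> (G (x, y) - w)) / (2 * \<alpha>) + \<beta> / 2 * (y \<bullet> u + u \<bullet> y))) (at y)"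
      by (intro has_derivative_add has_derivative_const bounded_linear.has_derivative[OF bounded_linear_divide]
          has_derivative_mult_right has_derivative_inner has_derivative_diff has_derivative_ident
          g_partial_der G_partial_der)
    have dot: "((G (x, y) - w) \<bullet> v + v \<bullet> (G (x, y) - w)) / (2 * \<alpha>) = p \<bullet> v" for v
    proof -
      have "p \<bullet> v = ((G (x, y) - w) \<bullet> v) / \<alpha>"
        by (simp only: p_def inner_scaleR_left times_divide_eq_left mult_1)
      then show ?thesis
        using \<alpha> by (simp add: inner_commute[of v] field_simps)
    qed
    show "(\<lambda>u. g' (x, y) (0, u) + 0 + ((G (x, y) - w) \<bullet> (G' (x, y) (0, u) - 0) +
        (G' (x, y) (0, u) - 0) \<bullet> (G (x, y) - w)) / (2 * \<alpha>) + \<beta> / 2 * (y \<bullet> u + u \<bullet> y)) =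
      (\<lambda>u. g' (x, y) (0, u) + p \<bullet> G' (x, y) (0, u) + \<beta> * (y \<bullet> u))"
      by (simp only: diff_zero add_0_right dot) (simp add: inner_commute)
  qed
  from has_derivative_local_min[OF this] min[OF wt]
  have "(\<lambda>u. g' (x, y) (0, u) + p \<bullet> G' (x, y) (0, u) + \<beta> * (y \<bullet> u)) = (\<lambda>_. 0)"
    by (simp add: \<Psi>_def power2_norm_eq_inner)
  then have stat: "g' (x, y) (0, u) + p \<bullet> G' (x, y) (0, u) + \<beta> * (y \<bullet> u) = 0" for u
    by (rule fun_cong)
  \<comment> \<open>Moving a fraction \<open>\<tau>\<close> of the way to \<open>(w', t')\<close>
    changes the penalty by a linear term plus \<open>\<tau> * (\<tau> * k)\<close>; after division
    by \<open>\<tau>\<close> the error is at most \<epsilon>.\<close>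
  have "t + p \<bullet> (w' - w) \<le> t'" if wt': "(w', t') \<in> E" for w' t'
  proof (rule field_le_epsilon)
    fix \<epsilon> :: real assume "\<epsilon> > 0"
    define k where "k = (norm (w' - w))\<^sup>2 / (2 * \<alpha>)"
    \<comment> \<open>The cap 1 keeps the moved point a convex combination; the denominator
      \<open>k + 1\<close> stays positive when \<open>k\<close> is 0.\<close>
    define \<tau> where "\<tau> = min 1 (\<epsilon> / (k + 1))"
    have "k \<ge> 0" using \<alpha> by (simp add: k_def)
    then have \<tau>: "0 < \<tau>" "\<tau> \<le> 1" "\<tau> * k \<le> \<epsilon>"
    proof -
      show "0 < \<tau>" "\<tau> \<le> 1" using \<open>\<epsilon> > 0\<close> \<open>k \<ge> 0\<close> by (auto simp: \<tau>_def)
      have "\<tau> * k \<le> \<epsilon> / (k + 1) * k"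
        using \<open>k \<ge> 0\<close> by (intro mult_right_mono) (auto simp: \<tau>_def)
      also have "\<dots> \<le> \<epsilon>" using \<open>\<epsilon> > 0\<close> \<open>k \<ge> 0\<close> by (simp add: field_simps)
      finally show "\<tau> * k \<le> \<epsilon>" .
    qed
    have "(w + \<tau> *\<^sub>R (w' - w), t + \<tau> * (t' - t)) \<in> E"
    proof -
      have "(1 - \<tau>) *\<^sub>R (w, t) + \<tau> *\<^sub>R (w', t') \<in> E"
        using polyhedron_imp_convex[OF E_poly] wt wt' \<tau> by (intro convexD) auto
      then show ?thesis by (simp add: algebra_simps)
    qed
    from min[OF this, of y]
    have "(norm (\<alpha> *\<^sub>R p))\<^sup>2 / (2 * \<alpha>) \<le>
        \<tau> * (t' - t) + (norm (\<alpha> *\<^sub>R p - \<tau> *\<^sub>R (w' - w)))\<^sup>2 / (2 * \<alpha>)"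
      by (simp add: \<Psi>_def w_eq algebra_simps)
    moreover have "(norm (\<alpha> *\<^sub>R p - \<tau> *\<^sub>R (w' - w)))\<^sup>2 / (2 * \<alpha>) =
        (norm (\<alpha> *\<^sub>R p))\<^sup>2 / (2 * \<alpha>) - \<tau> * (p \<bullet> (w' - w)) + \<tau> * (\<tau> * k)"
    proof -
      define s where "s = w' - w"
      have "(norm (\<alpha> *\<^sub>R p - \<tau> *\<^sub>R s))\<^sup>2 =
          (norm (\<alpha> *\<^sub>R p))\<^sup>2 - 2 * \<alpha> * (\<tau> * (p \<bullet> s)) + \<tau> * (\<tau> * (norm s)\<^sup>2)"
        unfolding power2_norm_eq_inner inner_diff_left inner_diff_right
        by (simp add: inner_commute[of s p])
      then show ?thesis
        using \<alpha> unfolding k_def s_def[symmetric]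
        by (simp only: add_divide_distrib diff_divide_distrib) simp
    qed
    ultimately have "0 \<le> \<tau> * (t' - t - p \<bullet> (w' - w) + \<tau> * k)"
      by (simp add: algebra_simps)
    then have "0 \<le> t' - t - p \<bullet> (w' - w) + \<tau> * k"
      using \<tau>(1) by (simp add: zero_le_mult_iff)
    then show "t + p \<bullet> (w' - w) \<le> t' + \<epsilon>" using \<tau>(3) by simp
  qed
  then have "epi_subgrad E w p"
    unfolding epi_subgrad_def using wt by blast
  then show ?thesis
    unfolding sol_def using stat w_eq by metis
qed

section \<open>The single-valued solution map and its selections\<close>

definition S :: "'a \<Rightarrow> 'b \<times> 'c" where
  "S x = (SOME yp. sol x (fst yp) (snd yp))"

lemma sol_S: "sol x (fst (S x)) (snd (S x))"
  unfolding S_def using sol_exists[of x] by (intro someI_ex[of "\<lambda>yp. sol x (fst yp) (snd yp)"]) auto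

lemma sol_iff_S: "sol x y p \<longleftrightarrow> (y, p) = S x"
  using sol_S[of x] sol_unique[of x y p "fst (S x)" "snd (S x)"] by (metis fst_conv prod.collapse snd_conv)

lemma continuous_S: "continuous_on UNIV S"
  unfolding continuous_on_def
proof
  fix x0
  obtain y0 p0 where S0: "S x0 = (y0, p0)" by fastforce
  define B where "B x = 2 / min \<alpha> \<beta> * (norm (G (x, y0) - G (x0, y0)) + norm (g' (x, y0) - g' (x0, y0)) +
      norm p0 * norm (G' (x, y0) - G' (x0, y0)))" for x
  have "norm (S x - S x0) \<le> B x" for x
  proof -
    obtain y p where S: "S x = (y, p)" by fastforce
    have "norm (S x - S x0) \<le> norm (y - y0) + norm (p - p0)"
      unfolding S S0 by (simp add: norm_Pair_le)
    also have "\<dots> \<le> B x"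
      unfolding B_def using S S0 by (intro sol_stable) (simp_all add: sol_iff_S)
    finally show ?thesis .
  qed
  then have "\<forall>\<^sub>F x in at x0. norm (S x - S x0) \<le> B x" by simp
  moreover have "continuous_on UNIV B"
    unfolding B_def
    by (intro continuous_intros continuous_on_compose2[OF continuous_G]
        continuous_on_compose2[OF continuous_g'] continuous_on_compose2[OF continuous_G']) auto
  then have "(B \<longlongrightarrow> B x0) (at x0)"
    by (simp add: continuous_on_def)
  then have "(B \<longlongrightarrow> 0) (at x0)"
    by (simp add: B_def)
  ultimately have "((\<lambda>x. S x - S x0) \<longlongrightarrow> 0) (at x0)"
    by (rule Lim_null_comparison)
  then show "(S \<longlongrightarrow> S x0) (at x0)"
    by (rule LIM_zero_cancel)
qed

text \<open>For a kernel vector \<open>(v, q)\<close> of the linearised system, test the first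
  equation with \<open>v\<close>. Convexity of \<open>g\<close> plus \<open>p0 \<bullet> G\<close>
  makes the second-order term nonnegative, and \<open>q = A (G' (x0, y0) (0, v))\<close> makes the
  coupling term nonnegative, so the \<beta> term forces \<open>v = 0\<close> and then
  \<open>q = 0\<close>.\<close>

lemma local_selection:
  assumes A: "linear A" "\<And>u. 0 \<le> u \<bullet> A u"
    and sol0: "sol x0 y0 p0" and p0: "p0 = A (G (x0, y0)) + b"
  obtains U W \<phi> where "open U" "x0 \<in> U" "open W" "(x0, y0, p0) \<in> W" "C1_on U \<phi>"
    "\<And>x y p. \<lbrakk>(x, y, p) \<in> W; sol x y p; p = A (G (x, y)) + b\<rbrakk> \<Longrightarrow> (y, p) = \<phi> x"
proof -
  obtain g'' where g'': "\<And>z. (g' has_derivative blinfun_apply (g'' z)) (at z)" "continuous_on UNIV g''"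
    using g'_C1 unfolding C1_on_def by auto
  obtain G'' where G'': "\<And>z. (G' has_derivative blinfun_apply (G'' z)) (at z)" "continuous_on UNIV G''"
    using G'_C1 unfolding C1_on_def by auto
  have A_bl: "bounded_linear A" using A(1) by (simp add: linear_conv_bounded_linear)
  define \<pi> where "\<pi> z = (fst z, fst (snd z))" for z :: "'a \<times> 'b \<times> 'c"
  \<comment> \<open>Collecting the stationarity equations over the basis gives \<open>H\<close>
    values in the space of the unknown \<open>(y, p)\<close>, as the implicit function theorem
    requires.\<close>
  define H where "H z = ((\<Sum>u\<in>Basis. (g' (\<pi> z) (0, u) + snd (snd z) \<bullet> G' (\<pi> z) (0, u)
      + \<beta> * (fst (snd z) \<bullet> u)) *\<^sub>R u), snd (snd z) - A (G (\<pi> z)) - b)" for z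
  define D where "D z d = ((\<Sum>u\<in>Basis. (g'' (\<pi> z) (\<pi> d) (0, u)
      + (snd (snd z) \<bullet> G'' (\<pi> z) (\<pi> d) (0, u) + snd (snd d) \<bullet> G' (\<pi> z) (0, u))
      + \<beta> * (fst (snd d) \<bullet> u)) *\<^sub>R u), snd (snd d) - A (G' (\<pi> z) (\<pi> d)) - 0)" for z d
  have \<pi>_der: "(\<pi> has_derivative \<pi>) (at z)" for z
    unfolding \<pi>_def [abs_def]
    by (intro has_derivative_Pair has_derivative_fst has_derivative_snd has_derivative_ident)
  have g'_der: "((\<lambda>z. g' (\<pi> z) v) has_derivative (\<lambda>d. g'' (\<pi> z) (\<pi> d) v)) (at z)" for z v
    by (rule bounded_linear.has_derivative[OF blinfun.bounded_linear_left has_derivative_compose[OF \<pi>_der g''(1)]])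
  have G'_der: "((\<lambda>z. G' (\<pi> z) v) has_derivative (\<lambda>d. G'' (\<pi> z) (\<pi> d) v)) (at z)" for z v
    by (rule bounded_linear.has_derivative[OF blinfun.bounded_linear_left has_derivative_compose[OF \<pi>_der G''(1)]])
  have H_der: "(H has_derivative D z) (at z)" for z
    unfolding H_def [abs_def] D_def [abs_def]
    by (intro has_derivative_Pair has_derivative_sum has_derivative_scaleR_left has_derivative_add
        has_derivative_inner has_derivative_mult_right has_derivative_inner_left has_derivative_diff
        has_derivative_const has_derivative_fst has_derivative_snd has_derivative_ident g'_der G'_der
        bounded_linear.has_derivative[OF A_bl] has_derivative_compose[OF \<pi>_der G_der])
  have cont_\<pi>: "continuous_on UNIV \<pi>"
    unfolding \<pi>_def [abs_def] by (intro continuous_intros)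
  have cont_A: "continuous_on UNIV A"
    using A_bl by (rule linear_continuous_on)
  have H_C1: "C1_on UNIV H"
  proof (rule C1_onI[OF H_der])
    show "continuous_on UNIV (\<lambda>z. D z d)" for d
      unfolding D_def
      by (intro continuous_intros continuous_on_compose2[OF cont_A]
          continuous_on_compose2[OF continuous_G' cont_\<pi>]
          continuous_on_compose2[OF g''(2) cont_\<pi>] continuous_on_compose2[OF G''(2) cont_\<pi>]) auto
  qed
  have H_zero: "H (x, y, p) = 0" if "sol x y p" "p = A (G (x, y)) + b" for x y p
    using that by (simp add: H_def \<pi>_def sol_def zero_prod_def)
  have inj: "d = 0" if D0: "D (x0, y0, p0) (0, d) = 0" for d
  proof -
    obtain v q where d: "d = (v, q)" by (cases d)
    define L where "L u = g'' (x0, y0) (0, v) (0, u)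
      + (p0 \<bullet> G'' (x0, y0) (0, v) (0, u) + q \<bullet> G' (x0, y0) (0, u)) + \<beta> * (v \<bullet> u)" for u
    have "(\<Sum>u\<in>Basis. L u *\<^sub>R u) = 0 \<and> q - A (G' (x0, y0) (0, v)) = 0"
      using D0 by (simp only: D_def \<pi>_def L_def d zero_prod_def fst_conv snd_conv diff_zero prod.inject)
    then have sum0: "(\<Sum>u\<in>Basis. L u *\<^sub>R u) = 0" and q: "q = A (G' (x0, y0) (0, v))"
      by simp_all
    \<comment> \<open>The sum yields \<open>L u = 0\<close> only for basis vectors; linearity
      carries it to the direction \<open>v\<close>.\<close>
    have "linear L"
    proof (rule linearI)
      have add: "(0::'a, u + u') = (0, u) + (0, u')" for u u' :: 'b by simp
      show "L (u + u') = L u + L u'" for u u'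
        unfolding L_def add by (simp only: blinfun.add_right inner_add_right distrib_left)
      have scale: "(0::'a, c *\<^sub>R u) = c *\<^sub>R (0, u)" for c and u :: 'b by simp
      show "L (c *\<^sub>R u) = c *\<^sub>R L u" for c u
        unfolding L_def scale by (simp only: blinfun.scaleR_right inner_scaleR_right)
          (simp add: algebra_simps)
    qed
    moreover have "L u = 0" if "u \<in> Basis" for u
      using arg_cong[OF sum0, of "\<lambda>s. s \<bullet> u"] that by simp
    ultimately have "L = (\<lambda>_. 0)"
      by (intro linear_eq_stdbasis linear_zero) auto
    then have Lv: "L v = 0" by simp
    have "0 \<le> g'' (x0, y0) (0, v) (0, v) + p0 \<bullet> G'' (x0, y0) (0, v) (0, v)"
    proof (rule convex_on_second_derivative_nonneg[where u = v
          and D' = "\<lambda>u. g'' (x0, y0) (0, u) (0, v) + p0 \<bullet> G'' (x0, y0) (0, u) (0, v)"])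
      show "convex_on UNIV (\<lambda>y. g (x0, y) + p0 \<bullet> G (x0, y))"
        using g_convex G_convex sol0 unfolding sol_def by (intro convex_on_add) blast+
      show "((\<lambda>y. g (x0, y) + p0 \<bullet> G (x0, y)) has_derivative
          (\<lambda>u. g' (x0, y) (0, u) + p0 \<bullet> G' (x0, y) (0, u))) (at y)" for y
        by (intro has_derivative_add has_derivative_inner_right g_partial_der G_partial_der)
      show "((\<lambda>y. g' (x0, y) (0, v) + p0 \<bullet> G' (x0, y) (0, v)) has_derivative
          (\<lambda>u. g'' (x0, y0) (0, u) (0, v) + p0 \<bullet> G'' (x0, y0) (0, u) (0, v))) (at y0)"
        by (intro has_derivative_add has_derivative_inner_right
            bounded_linear.has_derivative[OF blinfun.bounded_linear_left]
            has_derivative_compose[OF pair_der g''(1)] has_derivative_compose[OF pair_der G''(1)])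
    qed
    moreover have "0 \<le> q \<bullet> G' (x0, y0) (0, v)"
      using A(2)[of "G' (x0, y0) (0, v)"] by (simp add: q inner_commute)
    ultimately have "\<beta> * (v \<bullet> v) \<le> 0"
      using Lv by (simp add: L_def)
    then have "v \<bullet> v \<le> 0" using \<beta> by (simp add: mult_le_0_iff)
    then have "v = 0"
      using inner_ge_zero[of v] inner_eq_zero_iff[of v] by linarith
    moreover have "G' (x0, y0) (0, 0) = 0" by (simp flip: zero_prod_def)
    ultimately show ?thesis
      using q linear_0[OF A(1)] by (simp add: d zero_prod_def)
  qed
  obtain U W \<phi> where sel: "open U" "x0 \<in> U" "open W" "(x0, y0, p0) \<in> W" "C1_on U \<phi>"
    and \<phi>: "\<And>x v. \<lbrakk>(x, v) \<in> W; H (x, v) = 0\<rbrakk> \<Longrightarrow> v = \<phi> x"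
    by (rule implicit_function_C1[OF H_C1 H_zero[OF sol0 p0] H_der]) (erule inj, rule that)
  show thesis
    by (rule that[OF sel]) (rule \<phi>[OF _ H_zero])
qed

text \<open>A piece whose equation fails at \<open>x0\<close> still fails nearby, by continuity of
  \<open>S\<close>. So near \<open>x0\<close> the value \<open>S x\<close> satisfies the equation of
  an active piece and lies on the selection belonging to it.\<close>

lemma PC1_S: "PC1 S"
  unfolding PC1_def
proof (intro conjI allI continuous_S)
  fix x0
  obtain y0 p0 where S0: "S x0 = (y0, p0)" by fastforce
  then have sol0: "sol x0 y0 p0" by (simp add: sol_iff_S)
  obtain pieces where pieces: "finite pieces"
    "\<And>A b. (A, b) \<in> pieces \<Longrightarrow> linear A \<and> (\<forall>u. 0 \<le> u \<bullet> A u)"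
    "\<And>z p. epi_subgrad E (z - \<alpha> *\<^sub>R p) p \<Longrightarrow> \<exists>(A, b)\<in>pieces. p = A z + b"
    using polyhedral_resolvent_piecewise_affine[OF E_poly \<alpha>] by blast
  \<comment> \<open>Only these pieces admit a selection: \<open>local_selection\<close> needs the
    equation to hold at the base point.\<close>
  define active where "active = {(A, b) \<in> pieces. p0 = A (G (x0, y0)) + b}"
  have fin: "finite active"
    using pieces(1) by (auto simp: active_def intro: finite_subset[rotated])
  have "\<forall>c\<in>active. \<exists>U W \<phi>. open U \<and> x0 \<in> U \<and> open W \<and> (x0, y0, p0) \<in> W \<and> C1_on U \<phi> \<and>
    (\<forall>x y p. (x, y, p) \<in> W \<longrightarrow> sol x y p \<longrightarrow> p = fst c (G (x, y)) + snd c \<longrightarrow> (y, p) = \<phi> x)"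
  proof
    fix c assume "c \<in> active"
    then obtain A b where c: "c = (A, b)" "(A, b) \<in> pieces" "p0 = A (G (x0, y0)) + b"
      by (auto simp: active_def)
    obtain U W \<phi> where "open U" "x0 \<in> U" "open W" "(x0, y0, p0) \<in> W" "C1_on U \<phi>"
      "\<And>x y p. \<lbrakk>(x, y, p) \<in> W; sol x y p; p = A (G (x, y)) + b\<rbrakk> \<Longrightarrow> (y, p) = \<phi> x"
      using local_selection[of A, OF _ _ sol0 c(3)] pieces(2)[OF c(2)] by blast
    then show "\<exists>U W \<phi>. open U \<and> x0 \<in> U \<and> open W \<and> (x0, y0, p0) \<in> W \<and> C1_on U \<phi> \<and>
      (\<forall>x y p. (x, y, p) \<in> W \<longrightarrow> sol x y p \<longrightarrow> p = fst c (G (x, y)) + snd c \<longrightarrow> (y, p) = \<phi> x)"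
      unfolding c(1) fst_conv snd_conv by blast
  qed
  then obtain U W \<phi> where U: "\<And>c. c \<in> active \<Longrightarrow> open (U c) \<and> x0 \<in> U c"
    and W: "\<And>c. c \<in> active \<Longrightarrow> open (W c) \<and> (x0, y0, p0) \<in> W c"
    and C1: "\<And>c. c \<in> active \<Longrightarrow> C1_on (U c) (\<phi> c)"
    and \<phi>: "\<And>c x y p. \<lbrakk>c \<in> active; (x, y, p) \<in> W c; sol x y p; p = fst c (G (x, y)) + snd c\<rbrakk>
      \<Longrightarrow> (y, p) = \<phi> c x"
    unfolding bchoice_iff by metis
  define V where "V = (\<Inter>c\<in>active. U c)"
  have lim_S: "(S \<longlongrightarrow> (y0, p0)) (nhds x0)"
    using continuous_S S0 by (metis UNIV_I continuous_on_eq_continuous_at open_UNIV isCont_def tendsto_at_iff_tendsto_nhds)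
  have lim_G: "((\<lambda>x. G (x, fst (S x))) \<longlongrightarrow> G (x0, y0)) (nhds x0)"
  proof -
    have "((\<lambda>x. (x, fst (S x))) \<longlongrightarrow> (x0, y0)) (nhds x0)"
      using tendsto_fst[OF lim_S] by (intro tendsto_Pair) (auto simp: filterlim_ident)
    then show ?thesis
      using has_derivative_continuous[OF G_der] by (intro isCont_tendsto_compose[of _ G]) auto
  qed
  have ev_W: "\<forall>\<^sub>F x in nhds x0. \<forall>c\<in>active. (x, S x) \<in> W c"
  proof (rule eventually_ball_finite[OF fin], rule ballI)
    fix c assume "c \<in> active"
    have "((\<lambda>x. (x, S x)) \<longlongrightarrow> (x0, y0, p0)) (nhds x0)"
      by (intro tendsto_Pair lim_S) (auto simp: filterlim_ident)
    then show "\<forall>\<^sub>F x in nhds x0. (x, S x) \<in> W c"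
      using W[OF \<open>c \<in> active\<close>] by (intro topological_tendstoD) auto
  qed
  have ev_inactive: "\<forall>\<^sub>F x in nhds x0. \<forall>c\<in>pieces - active. snd (S x) \<noteq> fst c (G (x, fst (S x))) + snd c"
  proof (rule eventually_ball_finite, use pieces(1) in simp, rule ballI)
    fix c assume c: "c \<in> pieces - active"
    have "bounded_linear (fst c)"
      using pieces(2)[of "fst c" "snd c"] c by (simp add: linear_conv_bounded_linear)
    then have "((\<lambda>x. snd (S x) - (fst c (G (x, fst (S x))) + snd c)) \<longlongrightarrow> p0 - (fst c (G (x0, y0)) + snd c)) (nhds x0)"
      using tendsto_snd[OF lim_S] by (intro tendsto_intros bounded_linear.tendsto[OF _ lim_G]) auto
    moreover have "p0 - (fst c (G (x0, y0)) + snd c) \<noteq> 0"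
      using c by (auto simp: active_def)
    ultimately have "\<forall>\<^sub>F x in nhds x0. snd (S x) - (fst c (G (x, fst (S x))) + snd c) \<noteq> 0"
      by (rule tendsto_imp_eventually_ne)
    then show "\<forall>\<^sub>F x in nhds x0. snd (S x) \<noteq> fst c (G (x, fst (S x))) + snd c"
      by eventually_elim simp
  qed
  have "\<forall>\<^sub>F x in nhds x0. S x \<in> (\<lambda>\<phi>. \<phi> x) ` \<phi> ` active"
    using ev_W ev_inactive
  proof eventually_elim
    case (elim x)
    obtain y p where S: "S x = (y, p)" by fastforce
    then have sol: "sol x y p" by (simp add: sol_iff_S)
    then obtain c where c: "c \<in> pieces" "p = fst c (G (x, y)) + snd c"
      using pieces(3) unfolding sol_def by fastforce
    then have "c \<in> active" using elim(2) S by fastforce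
    then have "S x = \<phi> c x"
      using \<phi>[of c x y p] elim(1) S sol c(2) by simp
    then show ?case unfolding image_image using \<open>c \<in> active\<close> by (rule image_eqI)
  qed
  moreover have "open V" "x0 \<in> V"
    unfolding V_def using fin U by (auto intro!: open_INT)
  moreover have "\<forall>\<psi>\<in>\<phi> ` active. C1_on V \<psi>"
    using C1_on_subset[OF C1] unfolding V_def by blast
  ultimately show "\<exists>\<Phi> U. finite \<Phi> \<and> open U \<and> x0 \<in> U \<and> (\<forall>\<phi>\<in>\<Phi>. C1_on U \<phi>) \<and>
      (\<forall>\<^sub>F x in nhds x0. S x \<in> (\<lambda>\<phi>. \<phi> x) ` \<Phi>)"
    using fin by (intro exI[of _ "\<phi> ` active"] exI[of _ V]) simp
qed

end

section \<open>From gradients, Jacobians and components to the abstract system\<close>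

lemma gradient_inner:
  fixes f :: "'a::euclidean_space \<Rightarrow> real"
  assumes "(f has_derivative f') (at x)"
  shows "gradient f x \<bullet> u = f' u"
proof -
  have lin: "linear f'"
    using assms by (rule has_derivative_linear)
  \<comment> \<open>The Riesz representative of \<open>f'\<close>.\<close>
  define D where "D = (\<Sum>b\<in>Basis. f' b *\<^sub>R b)"
  have D: "f' = (\<lambda>u. u \<bullet> D)"
  proof (rule linear_eq_stdbasis[OF lin])
    show "linear (\<lambda>u. u \<bullet> D)" by (simp add: linear_iff inner_add_left)
    show "f' b = b \<bullet> D" if "b \<in> Basis" for b
      using that by (simp add: D_def inner_commute[of b])
  qed
  have "gradient f x = D"
    unfolding gradient_def
  proof (rule the_equality)
    show "GDERIV f x :> D"
      using assms unfolding gderiv_def D .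
    show "D' = D" if "GDERIV f x :> D'" for D'
      using has_derivative_unique[OF that[unfolded gderiv_def] assms] unfolding D
      by (metis vector_eq_ldot)
  qed
  then show ?thesis by (simp add: D inner_commute)
qed

lemma convex_on_weighted_sum:
  assumes "finite I" "\<And>i. i \<in> I \<Longrightarrow> 0 \<le> c i" "\<And>i. i \<in> I \<Longrightarrow> convex_on S (f i)" "convex S"
  shows "convex_on S (\<lambda>y. \<Sum>i\<in>I. c i * f i y :: real)"
  using assms(1-3)
proof (induction I rule: finite_induct)
  case empty
  then show ?case using assms(4) by (simp add: convex_on_def)
next
  case (insert i I)
  then show ?case by (simp add: convex_on_add convex_on_cmul)
qed

theorem theorem3p4:
  fixes g :: "(real^'n) \<times> (real^'m) \<Rightarrow> real"
    and G :: "(real^'n) \<times> (real^'m) \<Rightarrow> real^'s"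
    and h :: "real^'s \<Rightarrow> ereal"
    and \<alpha> \<beta> :: real
  assumes "C2 g" and "C2 G"
    and "\<And>x. convex_on UNIV (\<lambda>y. g (x, y))"
    and "\<And>x i. convex_on UNIV (\<lambda>y. G (x, y) $ i)"
    and "proper_fun h" and "epi_polyhedral h" and "mono h"
    and "\<alpha> > 0" and "\<beta> > 0"
  shows "(\<forall>x. is_singleton (S_map g G h \<alpha> \<beta> x)) \<and> PC1 (\<lambda>x. the_elem (S_map g G h \<alpha> \<beta> x))"
proof -
  let ?E = "ereal_epigraph h"
  obtain g' where g': "\<And>z. (g has_derivative blinfun_apply (g' z)) (at z)" "C1_on UNIV g'"
    using assms(1) unfolding C2_def by blast
  obtain G' where G': "\<And>z. (G has_derivative blinfun_apply (G' z)) (at z)" "C1_on UNIV G'"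
    using assms(2) unfolding C2_def by blast
  have poly: "polyhedron ?E"
    using assms(6) by (simp add: epi_polyhedral_def)
  have "\<exists>v p. epi_subgrad ?E v p"
  proof -
    obtain w0 where "h w0 \<noteq> \<infinity>" "h w0 \<noteq> -\<infinity>"
      using assms(5) by (auto simp: proper_fun_def)
    then obtain r0 where "h w0 = ereal r0" by (cases "h w0") auto
    then show ?thesis
      \<comment> \<open>The point one unit below a finite value of \<open>h\<close> is the one
        projected onto the epigraph.\<close>
      by (intro epi_subgrad_exists[of _ w0 r0 "r0 - 1"] polyhedron_imp_closed polyhedron_imp_convex poly)
        (auto simp: ereal_epigraph_def)
  qed
  \<comment> \<open>Monotonicity of \<open>h\<close> is used here: it makes the weights of the
    convex components nonnegative.\<close>
  moreover have "convex_on UNIV (\<lambda>y. p \<bullet> G (x, y))" if "epi_subgrad ?E v p" for v p x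
    unfolding inner_vec_def inner_real_def
    using epi_subgrad_nonneg[OF assms(7) that] assms(4) by (intro convex_on_weighted_sum) auto
  ultimately interpret regularized_system g G g' G' ?E \<alpha> \<beta>
    using assms g' G' poly by unfold_locales auto
  \<comment> \<open>The gradient equation is tested in all directions, which moves the transposed
    Jacobian onto the direction; the inclusion is dualised.\<close>
  have "(y, p) \<in> S_map g G h \<alpha> \<beta> x \<longleftrightarrow> sol x y p" for x y p
  proof -
    let ?grad = "gradient (\<lambda>y. g (x, y)) y" and ?J = "jacobian (\<lambda>y. G (x, y)) (at y)"
    have J: "?J *v u = G' (x, y) (0, u)" for u
    proof -
      have "((\<lambda>y. G (x, y)) has_derivative (\<lambda>u. ?J *v u)) (at y)"
        using G_partial_der jacobian_works differentiableI by blast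
      from has_derivative_unique[OF this G_partial_der] show ?thesis
        by (rule fun_cong)
    qed
    have zero_iff: "0 = - a - b - c \<longleftrightarrow> (\<forall>u. (a + b + c) \<bullet> u = 0)" for a b c :: "real^'m"
    proof -
      have "- a - b - c = - (a + b + c)" by simp
      then have "0 = - a - b - c \<longleftrightarrow> a + b + c = 0"
        by (simp only: neg_0_equal_iff_equal neg_equal_0_iff_equal eq_commute[of 0])
      then show ?thesis
        by (metis inner_eq_zero_iff inner_zero_left)
    qed
    have "0 = - ?grad - transpose ?J *v p - \<beta> *\<^sub>R y \<longleftrightarrow>
        (\<forall>u. (?grad + transpose ?J *v p + \<beta> *\<^sub>R y) \<bullet> u = 0)"
      by (rule zero_iff)
    also have "\<dots> \<longleftrightarrow> (\<forall>u. g' (x, y) (0, u) + p \<bullet> G' (x, y) (0, u) + \<beta> * (y \<bullet> u) = 0)"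
      by (simp add: inner_add_left gradient_inner[OF g_partial_der] dot_lmul_matrix J)
    finally have "0 = - ?grad - transpose ?J *v p - \<beta> *\<^sub>R y \<longleftrightarrow>
      (\<forall>u. g' (x, y) (0, u) + p \<bullet> G' (x, y) (0, u) + \<beta> * (y \<bullet> u) = 0)" .
    moreover have "0 \<in> (\<lambda>v. - G (x, y) + \<alpha> *\<^sub>R p + v) ` subdifferential (convex_conjugate h) p \<longleftrightarrow>
        G (x, y) - \<alpha> *\<^sub>R p \<in> subdifferential (convex_conjugate h) p"
    proof -
      have "0 = - G (x, y) + \<alpha> *\<^sub>R p + v \<longleftrightarrow> v = G (x, y) - \<alpha> *\<^sub>R p" for v
        by (auto simp: algebra_simps)
      then show ?thesis by (simp add: image_iff)
    qed
    ultimately show ?thesis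
      unfolding S_map_def sol_def
      using subdifferential_conjugate_iff[OF assms(5) polyhedron_imp_convex[OF poly]
          polyhedron_imp_closed[OF poly]] by simp
  qed
  then have "S_map g G h \<alpha> \<beta> x = {S x}" for x
    by (auto simp: sol_iff_S)
  then show ?thesis
    using PC1_S by simp
qed

end
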